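(* Let $1\le p_0<\infty$ and let $f$ and $g$ be two positive measurable functions on $\mathbb R^n$ such that, for every $w\in A_{p_0}$, $$\|g\|_{L^{p_0,\infty}(w)}\le \varphi(\|w\|_{A_{p_0}})\,\|f\|_{L^{p_0}(w)},$$ where $\varphi$ is a locally bounded function. Let $1<p,q<\infty$ and let $u,v$ be weights. If $(u,v)\in A_{\delta p,\delta q}$ for some $0<\delta<1$ and $(v^{1-q'},u^{1-p'})\in S_{\mu q',\mu p'}$ for some $0<\mu<1$, then $$\|g\|_{L^{q,\infty}(v)}\le C\|f\|_{L^p(u)},$$ with $C$ independent of $f$ and $g$ (it may depend on $\varphi$, the weights and the parameters).
   Context: Weights are positive locally integrable functions on $\mathbb R^n$. $M$ is the Hardy–Littlewood maximal operator $Mf(x)=\sup_{x\in Q}\frac1{|Q|}\int_Q|f|$ (supremum over cubes containing $x$). $\|g\|_{L^{p,\infty}(w)}=\sup_{y>0}y\,w(\{|g|>y\})^{1/p}$. $A_p$ (one index) is the Muckenhoupt class with $\|w\|_{A_p}=\sup_Q\big(\frac1{|Q|}\int_Qw\big)\big(\frac1{|Q|}\int_Qw^{-1/(p-1)}\big)^{p-1}$ for $1<p<\infty$ and $\|w\|_{A_1}=\sup_Q\big(\frac1{|Q|}\int_Qw\big)\|w^{-1}\|_{L^\infty(Q)}$. For $0<p,q<\infty$ and positive measurable functions $u,v$: $(u,v)\in A_{p,q}$ means that $M:L^p(u)\to L^{q,\infty}(v)$ is bounded, and $(u,v)\in S_{p,q}$ means that $M:L^p(u)\to L^q(v)$ is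 bounded. $p'$ is the conjugate exponent of $p$. A function $\varphi$ on $(0,\infty)$ is locally bounded if $\sup_{0<t<K}\varphi(t)<\infty$ for every $K>0$. *)

theory Defs
  imports "HOL-Analysis.Analysis" "HOL-Probability.Essential_Supremum"
begin

(* Real powers on [0,\<infinity>], intended for exponents a > 0 only, so that \<infinity>^a = \<infinity>. *)
definition ennpowr :: "ennreal \<Rightarrow> real \<Rightarrow> ennreal" where
  "ennpowr x a = (if x = \<infinity> then \<infinity> else ennreal (enn2real x powr a))"

definition conj_exp :: "real \<Rightarrow> real" where
  "conj_exp p = p / (p - 1)"

(* Non-degenerate closed cubes with sides parallel to the axes.  Taking open cubes instead
   changes neither the maximal function nor the A_p constants. *)
definition cube :: "(real ^ 'n) set \<Rightarrow> bool" where
  "cube Q \<longleftrightarrow> (\<exists>a l. 0 < l \<and> Q = cbox a (a + (\<chi> i. l)))"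

definition avg :: "(real ^ 'n) set \<Rightarrow> (real ^ 'n \<Rightarrow> ennreal) \<Rightarrow> ennreal" where
  "avg Q h = (\<integral>\<^sup>+x\<in>Q. h x \<partial>lebesgue) / emeasure lebesgue Q"

definition HL_maximal :: "(real ^ 'n \<Rightarrow> real) \<Rightarrow> real ^ 'n \<Rightarrow> ennreal" where
  "HL_maximal f x = (SUP Q\<in>{Q. cube Q \<and> x \<in> Q}. avg Q (\<lambda>y. ennreal \<bar>f y\<bar>))"

definition weight :: "(real ^ 'n \<Rightarrow> real) \<Rightarrow> bool" where
  "weight w \<longleftrightarrow> (\<forall>x. 0 < w x) \<and> w \<in> borel_measurable lebesgue
     \<and> (\<forall>K. compact K \<longrightarrow> set_integrable lebesgue K w)"

abbreviation weighted_measure :: "(real ^ 'n \<Rightarrow> real) \<Rightarrow> (real ^ 'n) measure" where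
  "weighted_measure w \<equiv> density lebesgue (\<lambda>x. ennreal (w x))"

(* Both norms take [0,\<infinity>]-valued arguments, since maximal functions may be infinite;
   a real function f enters as \<bar>f\<bar>. *)
definition Lp_norm :: "real \<Rightarrow> (real ^ 'n \<Rightarrow> real) \<Rightarrow> (real ^ 'n \<Rightarrow> ennreal) \<Rightarrow> ennreal" where
  "Lp_norm p w h = ennpowr (\<integral>\<^sup>+x. ennpowr (h x) p \<partial>weighted_measure w) (1 / p)"

definition weak_Lp_norm :: "real \<Rightarrow> (real ^ 'n \<Rightarrow> real) \<Rightarrow> (real ^ 'n \<Rightarrow> ennreal) \<Rightarrow> ennreal" where
  "weak_Lp_norm p w h =
     (SUP y\<in>{0<..}. ennreal y * ennpowr (emeasure (weighted_measure w) {x. ennreal y < h x}) (1 / p))"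

definition Ap_const :: "real \<Rightarrow> (real ^ 'n \<Rightarrow> real) \<Rightarrow> ennreal" where
  "Ap_const p w =
     (if p = 1
      then SUP Q\<in>Collect cube.
             avg Q (\<lambda>x. ennreal (w x)) * esssup (lebesgue_on Q) (\<lambda>x. ennreal (inverse (w x)))
      else SUP Q\<in>Collect cube.
             avg Q (\<lambda>x. ennreal (w x))
             * ennpowr (avg Q (\<lambda>x. ennreal (w x powr (- 1 / (p - 1))))) (p - 1))"

definition Ap_class :: "real \<Rightarrow> (real ^ 'n \<Rightarrow> real) set" where
  "Ap_class p = {w. weight w \<and> Ap_const p w < \<infinity>}"

definition Lp_space :: "real \<Rightarrow> (real ^ 'n \<Rightarrow> real) \<Rightarrow> (real ^ 'n \<Rightarrow> real) set" where
  "Lp_space p w = {f \<in> borel_measurable lebesgue. Lp_norm p w (\<lambda>x. ennreal \<bar>f x\<bar>) < \<infinity>}"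

(* The two-weight classes A_{p,q} and S_{p,q}: weak-type and strong-type boundedness of the
   maximal operator. *)
definition A_pair :: "real \<Rightarrow> real \<Rightarrow> ((real ^ 'n \<Rightarrow> real) \<times> (real ^ 'n \<Rightarrow> real)) set" where
  "A_pair p q = {(u, v). \<exists>C::real. \<forall>f\<in>Lp_space p u.
     weak_Lp_norm q v (HL_maximal f) \<le> ennreal C * Lp_norm p u (\<lambda>x. ennreal \<bar>f x\<bar>)}"

definition S_pair :: "real \<Rightarrow> real \<Rightarrow> ((real ^ 'n \<Rightarrow> real) \<times> (real ^ 'n \<Rightarrow> real)) set" where
  "S_pair p q = {(u, v). \<exists>C::real. \<forall>f\<in>Lp_space p u.
     Lp_norm q v (HL_maximal f) \<le> ennreal C * Lp_norm p u (\<lambda>x. ennreal \<bar>f x\<bar>)}"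

definition locally_bounded :: "(real \<Rightarrow> real) \<Rightarrow> bool" where
  "locally_bounded \<phi> \<longleftrightarrow> (\<forall>K>0. bdd_above (\<phi> ` {0<..<K}))"

end

theory Submission
  imports Defs
begin

text \<open>
  Write \<open>M\<^sub>a k = (M (k powr (1/a))) powr a\<close>.  By Coifman and Rochberg, \<open>M\<^sub>\<delta>\<close> and \<open>M\<^sub>\<mu>\<close> produce \<open>A\<^sub>1\<close> weights
  with constants depending only on the dimension and on \<open>\<delta>\<close>, \<open>\<mu>\<close>, and they dominate their
  arguments almost everywhere.  Fix \<open>y > 0\<close>.  Where \<open>M\<^sub>\<delta> f > y\<close>, the hypothesis on \<open>(u, v)\<close>
  bounds the \<open>v\<close>-measure.  On a bounded part \<open>E\<close> of \<open>{g > y, M\<^sub>\<delta> f \<le> y}\<close> put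
  \<open>h = M\<^sub>\<mu> (v \<chi>\<^sub>E)\<close>; then \<open>w = h * (M\<^sub>\<delta> f) powr (1 - p0)\<close> is a weight of class \<open>A\<close> with index
  \<open>p0\<close> and controlled constant, and the assumed weak-type inequality gives

  \<open>v(E) \<le> \<integral>\<^sub>E h \<le> y powr (p0 - 1) * w(g > y) \<le> (C / y) * \<integral> f h\<close>.

  Hoelder's inequality and the dual hypothesis bound the last integral by
  \<open>C * \<parallel>f\<parallel> * v(E) powr (1/q')\<close>, which is absorbed because \<open>v(E)\<close> is finite.
\<close>

subsection \<open>Powers on the extended half-line\<close>

text \<open>Raising to the power \<delta> turns boundedness of the maximal operator from
  L^(\<delta>p)(u) to weak L^(\<delta>q)(v) into a bound for the \<delta>-version from L^p(u) to
  weak L^q(v); \<mu> does the same on the dual side, where the function v on E has norm v(E)^(1/q')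
  in L^q'(v^(1-q')). Exponents below 1 leave the room needed for A_1: the maximal function itself is
  in general not an A_1 weight. Weak type fits the first role, where only a level set is measured; h
  is paired with f, so its full L^p' norm is used. The exponent 1 - p0 in w answers two demands. It
  makes w an A_p0 weight, and, because f lies below its majorant, it reduces f^p0 * w to f * h, a
  pairing in which p0 no longer occurs. Since \<phi> is only locally bounded, the constants of all
  weights w that arise must lie in one bounded interval. This is why the Coifman-Rochberg and
  product estimates carry explicit constants.\<close>

lemma ennpowr_ennreal: "0 \<le> x \<Longrightarrow> ennpowr (ennreal x) a = ennreal (x powr a)"
  by (simp add: ennpowr_def)

lemma ennpowr_top [simp]: "ennpowr top a = top"
  by (simp add: ennpowr_def)

lemma ennpowr_mono: "x \<le> y \<Longrightarrow> 0 \<le> a \<Longrightarrow> ennpowr x a \<le> ennpowr y a"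
  by (cases x; cases y) (auto simp: ennpowr_ennreal ennpowr_def top_unique intro!: powr_mono2)

lemma ennpowr_ennpowr: "0 < a \<Longrightarrow> ennpowr (ennpowr x a) b = ennpowr x (a * b)"
  by (cases x) (auto simp: ennpowr_ennreal ennpowr_def powr_powr)

lemma ennpowr_one [simp]: "ennpowr x 1 = x"
  by (cases x) (auto simp: ennpowr_ennreal ennpowr_def)

lemma ennpowr_le_iff:
  assumes "0 < a" "0 \<le> b"
  shows "ennpowr x (1 / a) \<le> ennreal b \<longleftrightarrow> x \<le> ennreal (b powr a)"
proof
  assume "ennpowr x (1 / a) \<le> ennreal b"
  from ennpowr_mono[OF this, of a] show "x \<le> ennreal (b powr a)"
    using assms by (simp add: ennpowr_ennpowr ennpowr_ennreal)
next
  assume "x \<le> ennreal (b powr a)"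
  from ennpowr_mono[OF this, of "1 / a"] show "ennpowr x (1 / a) \<le> ennreal b"
    using assms by (simp add: ennpowr_ennreal powr_powr)
qed

lemma ennpowr_measurable [measurable]: "(\<lambda>x. ennpowr x a) \<in> borel_measurable borel"
  unfolding ennpowr_def by measurable

subsection \<open>Cubes\<close>

text \<open>Centre and half-side instead of corner and side: dilating a cube about its centre is
  then multiplication of \<open>r\<close>.\<close>

definition ccube :: "real ^ 'n \<Rightarrow> real \<Rightarrow> (real ^ 'n) set" where
  "ccube c r = cbox (c - (\<chi> i. r)) (c + (\<chi> i. r))"

definition ocube :: "real ^ 'n \<Rightarrow> real \<Rightarrow> (real ^ 'n) set" where
  "ocube c r = box (c - (\<chi> i. r)) (c + (\<chi> i. r))"

lemma mem_ccube: "x \<in> ccube c r \<longleftrightarrow> (\<forall>i. \<bar>x $ i - c $ i\<bar> \<le> r)"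
  unfolding ccube_def mem_box_cart by (auto simp: abs_le_iff algebra_simps)

lemma mem_ocube: "x \<in> ocube c r \<longleftrightarrow> (\<forall>i. \<bar>x $ i - c $ i\<bar> < r)"
  unfolding ocube_def mem_box_cart by (auto simp: abs_less_iff algebra_simps)

lemma cube_iff: "cube Q \<longleftrightarrow> (\<exists>c r. 0 < r \<and> Q = ccube c r)"
proof
  assume "cube Q"
  then obtain a l where l: "0 < l" "Q = cbox a (a + (\<chi> i. l))" by (auto simp: cube_def)
  have "Q = ccube (a + (\<chi> i. l / 2)) (l / 2)"
    unfolding l ccube_def by (rule arg_cong2[where f = cbox]) (auto simp: vec_eq_iff)
  then show "\<exists>c r. 0 < r \<and> Q = ccube c r" using l(1) by (intro exI[of _ "_"] conjI) auto
next
  assume "\<exists>c r. 0 < r \<and> Q = ccube c r"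
  then obtain c r where r: "0 < r" "Q = ccube c r" by auto
  have "Q = cbox (c - (\<chi> i. r)) (c - (\<chi> i. r) + (\<chi> i. 2 * r))"
    unfolding r ccube_def by (rule arg_cong2[where f = cbox]) (auto simp: vec_eq_iff)
  then show "cube Q" unfolding cube_def using r(1) by (intro exI[of _ "_"] conjI) auto
qed

lemma cube_ccube: "0 < r \<Longrightarrow> cube (ccube c r)"
  by (auto simp: cube_iff)

lemma sets_ccube [measurable]: "ccube c r \<in> sets lebesgue"
  by (simp add: ccube_def)

lemma open_ocube: "open (ocube c r)"
  by (simp add: ocube_def open_box)

lemma ocube_subset_ccube: "ocube c r \<subseteq> ccube c r"
  by (auto simp: mem_ocube mem_ccube) (meson less_imp_le)

lemma emeasure_ccube:
  fixes c :: "real ^ 'n"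
  assumes "0 \<le> r"
  shows "emeasure lebesgue (ccube c r) = ennreal ((2 * r) ^ CARD('n))"
proof -
  have "emeasure lebesgue (ccube c r) = ennreal (measure lebesgue (ccube c r))"
    unfolding ccube_def by (simp add: emeasure_eq_measure2)
  also have "measure lebesgue (ccube c r) = measure lborel (ccube c r)"
    unfolding ccube_def by simp
  also have "\<dots> = (2 * r) ^ CARD('n)"
    unfolding ccube_def
  proof (subst content_cbox_cart)
    show "cbox (c - (\<chi> i. r)) (c + (\<chi> i. r)) \<noteq> {}"
      using assms by (auto simp: interval_ne_empty_cart)
  qed simp
  finally show ?thesis .
qed

lemma emeasure_ccube_triple:
  fixes c :: "real ^ 'n"
  assumes "0 \<le> r"
  shows "emeasure lebesgue (ccube c (3 * r)) = 3 ^ CARD('n) * emeasure lebesgue (ccube c r)"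
proof -
  have "emeasure lebesgue (ccube c (3 * r)) = ennreal ((2 * (3 * r)) ^ CARD('n))"
    using assms by (intro emeasure_ccube) simp
  also have "(2 * (3 * r)) ^ CARD('n) = 3 ^ CARD('n) * (2 * r) ^ CARD('n)"
    unfolding power_mult_distrib[symmetric] by simp
  also have "ennreal \<dots> = ennreal (3 ^ CARD('n)) * ennreal ((2 * r) ^ CARD('n))"
    using assms by (intro ennreal_mult) auto
  also have "ennreal (3 ^ CARD('n)) = 3 ^ CARD('n)"
    by (simp add: ennreal_power[symmetric])
  also have "ennreal ((2 * r) ^ CARD('n)) = emeasure lebesgue (ccube c r)"
    using assms by (intro emeasure_ccube[symmetric])
  finally show ?thesis .
qed

text \<open>Triangle inequality in the sup norm along y, c, x, c', with steps of length at most r, r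
  and r'. With both cubes equal it also gives that a cube lies in its triple.\<close>

lemma ccube_triple:
  assumes "x \<in> ccube c r" "x \<in> ccube c' r'" "r \<le> r'"
  shows "ccube c r \<subseteq> ccube c' (3 * r')"
proof
  fix y assume y: "y \<in> ccube c r"
  show "y \<in> ccube c' (3 * r')"
    unfolding mem_ccube
  proof
    fix i
    have "\<bar>y $ i - c $ i\<bar> \<le> r" "\<bar>x $ i - c $ i\<bar> \<le> r" "\<bar>x $ i - c' $ i\<bar> \<le> r'"
      using y assms by (auto simp: mem_ccube)
    then show "\<bar>y $ i - c' $ i\<bar> \<le> 3 * r'" using assms(3) by linarith
  qed
qed

lemma emeasure_cube:
  assumes "cube Q"
  shows "0 < emeasure lebesgue Q" "emeasure lebesgue Q < \<infinity>" "Q \<in> sets lebesgue"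
proof -
  obtain c r where "0 < r" "Q = ccube c r" using assms by (auto simp: cube_iff)
  then show "0 < emeasure lebesgue Q" "emeasure lebesgue Q < \<infinity>" "Q \<in> sets lebesgue"
    using emeasure_ccube[of r c] by (simp_all del: emeasure_completion)
qed

lemma ccube_mono: "r \<le> s \<Longrightarrow> ccube c r \<subseteq> ccube c s"
  unfolding mem_ccube subset_iff by (meson order_trans)

lemma norm_le_mem_ccube: "norm (x - c) \<le> r \<Longrightarrow> x \<in> ccube c r"
  unfolding mem_ccube using component_le_norm_cart[of "x - c"] by (auto intro: order_trans)

text \<open>Greedy choice: keep a cube \<open>m\<close> of largest half-side. Every cube meeting it
  lies in its triple, and the induction hypothesis handles the cubes disjoint from it.\<close>

lemma finite_Vitali_cubes:
  fixes c :: "'i \<Rightarrow> real ^ 'n"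
  assumes "finite I"
  shows "\<exists>J\<subseteq>I. disjoint_family_on (\<lambda>i. ccube (c i) (r i)) J \<and>
           (\<forall>i\<in>I. \<exists>j\<in>J. ccube (c i) (r i) \<subseteq> ccube (c j) (3 * r j))"
  using assms
proof (induction I rule: finite_psubset_induct)
  case (psubset I)
  show ?case
  proof (cases "I = {}")
    case False
    let ?Q = "\<lambda>i. ccube (c i) (r i)"
    have "Max (r ` I) \<in> r ` I"
      using psubset.hyps False by (intro Max_in) auto
    then obtain m where m: "m \<in> I" "Max (r ` I) = r m" by (rule imageE) simp
    have max: "r i \<le> r m" if "i \<in> I" for i
      unfolding m(2)[symmetric] using psubset.hyps that by (intro Max_ge) auto
    define I' where "I' = {i\<in>I. i \<noteq> m \<and> ?Q i \<inter> ?Q m = {}}"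
    have "I' \<subset> I" using m(1) by (auto simp: I'_def)
    from psubset.IH[OF this] obtain J where J: "J \<subseteq> I'" "disjoint_family_on ?Q J"
      "\<forall>i\<in>I'. \<exists>j\<in>J. ?Q i \<subseteq> ccube (c j) (3 * r j)"
      by (elim exE conjE)
    show ?thesis
    proof (intro exI[of _ "insert m J"] conjI ballI)
      show "insert m J \<subseteq> I" using J(1) m(1) by (auto simp: I'_def)
      show "disjoint_family_on ?Q (insert m J)"
      proof (subst disjoint_family_on_insert)
        show "m \<notin> J" using J(1) by (auto simp: I'_def)
        have "?Q m \<inter> ?Q j = {}" if "j \<in> J" for j
          using J(1) that by (auto simp: I'_def)
        then show "?Q m \<inter> \<Union> (?Q ` J) = {} \<and> disjoint_family_on ?Q J"
          using J(2) by blast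
      qed
      fix i assume i: "i \<in> I"
      show "\<exists>j\<in>insert m J. ?Q i \<subseteq> ccube (c j) (3 * r j)"
      proof (cases "i \<in> I'")
        case True then show ?thesis using J(3) by blast
      next
        case nin: False
        have "?Q i \<subseteq> ccube (c m) (3 * r m)"
        proof (cases "?Q i \<inter> ?Q m = {}")
          case True
          \<comment> \<open>Disjoint from cube \<open>m\<close> and yet outside \<open>I'\<close>,
            the index must be \<open>m\<close> itself; a cube disjoint from itself is empty, which
            happens when the half-side is negative.\<close>
          then have "?Q i = {}" using nin i by (cases "i = m") (auto simp: I'_def)
          then show ?thesis by simp
        next
          case False
          then obtain x where "x \<in> ?Q i" "x \<in> ?Q m" by blast
          then show ?thesis by (rule ccube_triple[OF _ _ max[OF i]])
        qed
        then show ?thesis by blast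
      qed
    qed
  qed (auto simp: disjoint_family_on_def)
qed

subsection \<open>The maximal function\<close>

text \<open>The maximal operator on [0,\<infinity>]-valued functions, so that averages can be
  treated as values of the measure \<open>density lebesgue h\<close> with no integrability
  assumption.\<close>

definition MM :: "(real ^ 'n \<Rightarrow> ennreal) \<Rightarrow> real ^ 'n \<Rightarrow> ennreal" where
  "MM h x = (SUP Q\<in>{Q. cube Q \<and> x \<in> Q}. avg Q h)"

lemma HL_maximal_eq: "HL_maximal f = MM (\<lambda>y. ennreal \<bar>f y\<bar>)"
  by (simp add: HL_maximal_def MM_def fun_eq_iff)

lemma avg_density:
  assumes "h \<in> borel_measurable lebesgue" "Q \<in> sets lebesgue"
  shows "avg Q h = emeasure (density lebesgue h) Q / emeasure lebesgue Q"
  using assms by (simp add: avg_def emeasure_density)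

lemma ennreal_less_divide_iff:
  fixes a b :: ennreal
  assumes "0 < c"
  shows "a < b / ennreal c \<longleftrightarrow> a * ennreal c < b"
proof (cases a; cases b)
  fix x y assume "a = ennreal x" "0 \<le> x" "b = ennreal y" "0 \<le> y"
  then show ?thesis using assms
    by (simp add: divide_ennreal ennreal_mult[symmetric] ennreal_less_iff pos_less_divide_eq)
qed (use assms in \<open>auto simp: ennreal_top_divide ennreal_top_mult ennreal_mult_less_top top_unique
       divide_ennreal ennreal_mult[symmetric]\<close>)

lemma less_avg_iff:
  fixes h :: "real ^ 'n \<Rightarrow> ennreal"
  assumes "h \<in> borel_measurable lebesgue" "0 < r"
  shows "t < avg (ccube c r) h \<longleftrightarrow>
    t * ennreal ((2 * r) ^ CARD('n)) < emeasure (density lebesgue h) (ccube c r)"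
  unfolding avg_density[OF assms(1) sets_ccube] emeasure_ccube[OF less_imp_le[OF assms(2)]]
  using assms(2) by (intro ennreal_less_divide_iff) simp

lemma avg_le_iff:
  fixes h :: "real ^ 'n \<Rightarrow> ennreal"
  assumes "h \<in> borel_measurable lebesgue" "cube Q"
  shows "avg Q h \<le> t \<longleftrightarrow> emeasure (density lebesgue h) Q \<le> t * emeasure lebesgue Q"
proof -
  obtain c r where Q: "0 < r" "Q = ccube c r" using assms(2) by (auto simp: cube_iff)
  show ?thesis
    using less_avg_iff[OF assms(1) Q(1), of t c] emeasure_ccube[of r c] Q
    by (simp add: not_less[symmetric] del: emeasure_completion)
qed

lemma emeasure_le_MM:
  assumes "h \<in> borel_measurable lebesgue" "cube Q" "x \<in> Q"
  shows "emeasure (density lebesgue h) Q \<le> MM h x * emeasure lebesgue Q"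
  unfolding avg_le_iff[OF assms(1,2), symmetric] MM_def
  using assms by (intro SUP_upper) auto

text \<open>Enlarging a closed cube slightly keeps its average above t, because the volume is
  continuous in the half-side and the mass can only grow; x then lies in the interior. Hence
  superlevel sets are open, which gives both measurability and an open cover for the weak-type
  bound.\<close>

lemma MM_greater_iff:
  assumes h: "h \<in> borel_measurable lebesgue"
  shows "ennreal t < MM h x \<longleftrightarrow> (\<exists>c r. 0 < r \<and> ennreal t < avg (ccube c r) h \<and> x \<in> ocube c r)"
    (is "_ = ?R")
proof
  assume ?R
  then obtain c r where "0 < r" "ennreal t < avg (ccube c r) h" "x \<in> ocube c r" by blast
  then show "ennreal t < MM h x"
    using ocube_subset_ccube[of c r] cube_ccube[of r c]
    unfolding MM_def less_SUP_iff by blast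
next
  assume "ennreal t < MM h x"
  then obtain c r where cr: "0 < r" "x \<in> ccube c r" "ennreal t < avg (ccube c r) h"
    unfolding MM_def less_SUP_iff cube_iff by blast
  let ?\<nu> = "emeasure (density lebesgue h)"
  have "ennreal t * ennreal ((2 * r) ^ CARD('a)) < ?\<nu> (ccube c r)"
    using cr less_avg_iff[OF h] by blast
  moreover have "((\<lambda>s. ennreal t * ennreal ((2 * s) ^ CARD('a))) \<longlongrightarrow> ennreal t * ennreal ((2 * r) ^ CARD('a))) (at_right r)"
    by (intro ennreal_tendsto_cmult tendsto_ennrealI tendsto_intros) simp
  ultimately have "eventually (\<lambda>s. ennreal t * ennreal ((2 * s) ^ CARD('a)) < ?\<nu> (ccube c r)) (at_right r)"
    by (intro order_tendstoD(2))
  moreover have "eventually (\<lambda>s. r < s) (at_right r)"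
    by (rule eventually_at_right_less)
  ultimately have "eventually (\<lambda>s. r < s \<and> ennreal t * ennreal ((2 * s) ^ CARD('a)) < ?\<nu> (ccube c r)) (at_right r)"
    by eventually_elim simp
  then obtain s where s: "r < s" "ennreal t * ennreal ((2 * s) ^ CARD('a)) < ?\<nu> (ccube c r)"
    using eventually_happens[of _ "at_right r"] by (auto simp: trivial_limit_at_right_real)
  have sub: "ccube c r \<subseteq> ocube c s"
    using s(1) by (auto simp: mem_ccube mem_ocube) (meson le_less_trans)
  then have "?\<nu> (ccube c r) \<le> ?\<nu> (ccube c s)"
    using ocube_subset_ccube[of c s] by (intro emeasure_mono) auto
  with s have "ennreal t * ennreal ((2 * s) ^ CARD('a)) < ?\<nu> (ccube c s)" by order
  then have "ennreal t < avg (ccube c s) h"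
    using less_avg_iff[OF h, of s] s(1) cr(1) by simp
  then show ?R using s(1) cr sub by (intro exI[of _ c] exI[of _ s]) auto
qed

lemma MM_superlevel:
  assumes h: "h \<in> borel_measurable lebesgue"
  shows "{x. ennreal t < MM h x} =
    (\<Union>(c, r)\<in>{(c, r). 0 < r \<and> ennreal t < avg (ccube c r) h}. ocube c r)"
  using MM_greater_iff[OF h] by auto

lemma MM_measurable [measurable]:
  assumes h: "h \<in> borel_measurable lebesgue"
  shows "MM h \<in> borel_measurable lebesgue"
proof (rule borel_measurableI_greater)
  fix y
  show "{x \<in> space lebesgue. y < MM h x} \<in> sets lebesgue"
  proof (cases y)
    case (real t)
    have "open {x. ennreal t < MM h x}"
      unfolding MM_superlevel[OF h] using open_ocube by (intro open_UN) auto
    then show ?thesis using real by simp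
  qed simp
qed

text \<open>Among finitely many cubes with average above t, Vitali selection leaves disjoint ones
  whose triples cover the rest, at the price of 3^n. Lindelof's theorem reduces the whole superlevel
  set to countably many open cubes, and continuity from below passes from finite unions to their
  limit.\<close>

lemma MM_weak_type:
  fixes h :: "real ^ 'n \<Rightarrow> ennreal"
  assumes h[measurable]: "h \<in> borel_measurable lebesgue"
  shows "ennreal t * emeasure lebesgue {x. ennreal t < MM h x}
           \<le> 3 ^ CARD('n) * emeasure (density lebesgue h) UNIV"
proof -
  define P where "P = {(c, r). 0 < r \<and> ennreal t < avg (ccube c r) h}"
  let ?\<nu> = "emeasure (density lebesgue h)"
  let ?O = "\<lambda>p. ocube (fst p) (snd p)"
  let ?Q = "\<lambda>p. ccube (fst p) (snd p)"
  have fin: "ennreal t * emeasure lebesgue (\<Union> (?O ` I)) \<le> 3 ^ CARD('n) * ?\<nu> UNIV"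
    if I: "finite I" "I \<subseteq> P" for I
  proof -
    obtain J where J: "J \<subseteq> I" "disjoint_family_on ?Q J"
      "\<forall>i\<in>I. \<exists>j\<in>J. ?Q i \<subseteq> ccube (fst j) (3 * snd j)"
      using finite_Vitali_cubes[OF I(1), of fst snd] by blast
    have fJ: "finite J" using J(1) I(1) by (rule finite_subset)
    have "\<Union> (?O ` I) \<subseteq> (\<Union>j\<in>J. ccube (fst j) (3 * snd j))"
    proof
      fix x assume "x \<in> \<Union> (?O ` I)"
      then obtain i where i: "i \<in> I" "x \<in> ?O i" by blast
      then obtain j where "j \<in> J" "?Q i \<subseteq> ccube (fst j) (3 * snd j)" using J(3) by blast
      then show "x \<in> (\<Union>j\<in>J. ccube (fst j) (3 * snd j))"
        using i(2) ocube_subset_ccube[of "fst i" "snd i"] by blast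
    qed
    then have "emeasure lebesgue (\<Union> (?O ` I)) \<le> emeasure lebesgue (\<Union>j\<in>J. ccube (fst j) (3 * snd j))"
      using fJ by (intro emeasure_mono sets.finite_UN) auto
    also have "\<dots> \<le> (\<Sum>j\<in>J. emeasure lebesgue (ccube (fst j) (3 * snd j)))"
      using fJ by (intro emeasure_subadditive_finite) auto
    also have "\<dots> = (\<Sum>j\<in>J. 3 ^ CARD('n) * emeasure lebesgue (?Q j))"
      using J(1) I(2) by (intro sum.cong emeasure_ccube_triple) (auto simp: P_def)
    finally have "ennreal t * emeasure lebesgue (\<Union> (?O ` I))
        \<le> ennreal t * (\<Sum>j\<in>J. 3 ^ CARD('n) * emeasure lebesgue (?Q j))"
      by (intro mult_left_mono) auto
    also have "\<dots> = 3 ^ CARD('n) * (\<Sum>j\<in>J. ennreal t * emeasure lebesgue (?Q j))"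
      unfolding sum_distrib_left by (simp only: mult.left_commute)
    also have "\<dots> \<le> 3 ^ CARD('n) * (\<Sum>j\<in>J. ?\<nu> (?Q j))"
    proof (intro mult_left_mono sum_mono)
      fix j assume "j \<in> J"
      then have j: "0 < snd j" "ennreal t < avg (?Q j) h" using J(1) I(2) by (auto simp: P_def)
      from j(2) show "ennreal t * emeasure lebesgue (?Q j) \<le> ?\<nu> (?Q j)"
        unfolding emeasure_ccube[OF less_imp_le[OF j(1)]] less_avg_iff[OF h j(1)]
        by (rule less_imp_le)
    qed simp
    also have "(\<Sum>j\<in>J. ?\<nu> (?Q j)) = ?\<nu> (\<Union>j\<in>J. ?Q j)"
      using fJ J(2) by (intro sum_emeasure) auto
    also have "3 ^ CARD('n) * \<dots> \<le> 3 ^ CARD('n) * ?\<nu> UNIV"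
      by (intro mult_left_mono emeasure_mono) auto
    finally show ?thesis .
  qed
  obtain F where F: "F \<subseteq> ?O ` P" "countable F" "\<Union>F = \<Union> (?O ` P)"
    using Lindelof[of "?O ` P"] open_ocube by blast
  then obtain P' where P': "countable P'" "P' \<subseteq> P" "F = ?O ` P'"
    using countable_subset_image[of F ?O P] by auto
  have eq: "{x. ennreal t < MM h x} = \<Union> (?O ` P')"
    using F(3) P'(3) unfolding MM_superlevel[OF h] P_def by (simp add: case_prod_beta)
  show ?thesis
  proof (cases "P' = {}")
    case False
    define e where "e = from_nat_into P'"
    have e: "range e = P'" unfolding e_def using False P'(1) by (rule range_from_nat_into)
    define A where "A = (\<lambda>k. \<Union> (?O ` (e ` {..k::nat})))"
    have A: "range A \<subseteq> sets lebesgue" unfolding A_def by (auto simp: ocube_def)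
    have inc: "incseq A" unfolding A_def by (intro incseq_SucI) (auto simp: atMost_Suc)
    have "{x. ennreal t < MM h x} = (\<Union>k. A k)"
      unfolding eq e[symmetric] A_def by auto
    then have "ennreal t * emeasure lebesgue {x. ennreal t < MM h x}
        = (SUP k. ennreal t * emeasure lebesgue (A k))"
      by (simp only: SUP_emeasure_incseq[OF A inc, symmetric] SUP_mult_left_ennreal)
    also have "\<dots> \<le> 3 ^ CARD('n) * ?\<nu> UNIV"
      unfolding A_def using e P'(2) by (intro SUP_least fin) auto
    finally show ?thesis .
  qed (simp add: eq)
qed

text \<open>If the maximal function vanished at z, no cube centred at z would carry mass, and these
  cubes exhaust the space. It keeps the weights built from powers of \<open>MM h\<close> positive at
  every point.\<close>

lemma MM_pos:
  assumes h[measurable]: "h \<in> borel_measurable lebesgue" and "0 < (\<integral>\<^sup>+x. h x \<partial>lebesgue)"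
  shows "0 < MM h z"
proof (rule ccontr)
  assume "\<not> 0 < MM h z"
  then have 0: "MM h z = 0" by simp
  let ?\<nu> = "emeasure (density lebesgue h)"
  have "?\<nu> (ccube z (real (Suc k))) = 0" for k
    using emeasure_le_MM[OF h cube_ccube, of "real (Suc k)" z z]
    by (simp add: 0 mem_ccube del: emeasure_completion of_nat_Suc)
  then have "(\<Union>k. ccube z (real (Suc k))) \<in> null_sets (density lebesgue h)"
    by (intro null_sets_UN) (auto simp: null_sets_def)
  moreover have "(\<Union>k. ccube z (real (Suc k))) = UNIV"
  proof (intro UNIV_eq_I[symmetric])
    fix x
    obtain k where k: "norm (x - z) < real k" using reals_Archimedean2 by blast
    then have "x \<in> ccube z (real (Suc k))"
      by (intro norm_le_mem_ccube) simp
    then show "x \<in> (\<Union>k. ccube z (real (Suc k)))" by blast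
  qed
  ultimately have "?\<nu> UNIV = 0" by auto
  then show False using assms(2) by (simp add: emeasure_density del: nn_integral_completion)
qed

subsection \<open>The Kolmogorov and Coifman-Rochberg inequalities\<close>

text \<open>The summand 1 accounts for the values up to the base level; the fraction is the
  geometric series of the dyadic levels above it, with ratio 2^(\<delta> - 1), convergent exactly
  when \<delta> < 1.\<close>

definition Kolmogorov_const :: "real \<Rightarrow> real" where
  "Kolmogorov_const \<delta> = 1 + 2 powr \<delta> / (1 - 2 powr (\<delta> - 1))"

lemma Kolmogorov_const_sum:
  assumes "\<delta> < 1"
  shows "1 \<le> Kolmogorov_const \<delta>"
    and "(\<lambda>j. 2 powr \<delta> * (2 powr (\<delta> - 1)) ^ j) sums (Kolmogorov_const \<delta> - 1)"
proof -
  have lt: "2 powr (\<delta> - 1) < (1::real)" using assms by (simp add: powr_less_one)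
  then show "1 \<le> Kolmogorov_const \<delta>" by (simp add: Kolmogorov_const_def)
  show "(\<lambda>j. 2 powr \<delta> * (2 powr (\<delta> - 1)) ^ j) sums (Kolmogorov_const \<delta> - 1)"
    using sums_mult[OF geometric_sums[of "2 powr (\<delta> - 1)"], of "2 powr \<delta>"] lt
    by (simp add: Kolmogorov_const_def)
qed

text \<open>Discrete form of the layer-cake formula. Let n be least with y \<le> 2^n * A. If n = 0
  the first term suffices; otherwise the single summand j = n - 1 does, since it is switched on by
  2^j * A < y and its value uses the next level, 2^n * A.\<close>

lemma ennpowr_le_dyadic_sum:
  assumes "0 < A" "0 < \<delta>" "y < \<infinity>"
  shows "ennpowr y \<delta> \<le> ennreal (A powr \<delta>)
    + (\<Sum>j. ennreal ((2 ^ Suc j * A) powr \<delta>) * indicator {t. ennreal (2 ^ j * A) < t} y)"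
    (is "_ \<le> _ + suminf ?s")
proof -
  obtain r where r: "y = ennreal r" "0 \<le> r" using assms(3) by (cases y) auto
  obtain n where "r / A < 2 ^ n" using real_arch_pow[of 2 "r / A"] by auto
  then have ex: "\<exists>n. r \<le> 2 ^ n * A" using assms(1) by (auto simp: field_simps intro: less_imp_le)
  define n where "n = (LEAST n. r \<le> 2 ^ n * A)"
  have n: "r \<le> 2 ^ n * A" unfolding n_def using ex by (rule LeastI_ex)
  show ?thesis
  proof (cases n)
    case 0
    then have "ennpowr y \<delta> \<le> ennreal (A powr \<delta>)"
      using n r assms by (simp add: ennpowr_ennreal powr_mono2)
    then show ?thesis by (rule order_trans) simp
  next
    case (Suc j)
    have "\<not> r \<le> 2 ^ j * A" using not_less_Least[of j "\<lambda>n. r \<le> 2 ^ n * A"] Suc by (simp add: n_def)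
    then have "ennreal (2 ^ j * A) < y" using r assms by (simp add: ennreal_less_iff)
    then have "ennpowr y \<delta> \<le> ?s j"
      using n r assms Suc by (simp add: ennpowr_ennreal powr_mono2)
    also have "\<dots> \<le> suminf ?s"
      using sum_le_suminf[OF summableI, of "{j}" ?s] by (simp only: sum.insert_if sum.empty finite.emptyI) simp
    finally show ?thesis by (simp add: add_increasing)
  qed
qed

text \<open>By the weak bound, the level set at 2^j * A has at most 2^(-j) times the measure of B.
  Against the factor (2^(j+1) * A)^\<delta> this leaves a convergent geometric series.\<close>

lemma Kolmogorov_inequality:
  assumes F[measurable]: "F \<in> borel_measurable M" and B[measurable]: "B \<in> sets M"
    and A: "0 < A" and \<delta>: "0 < \<delta>" "\<delta> < 1" and fin: "AE x in M. F x < \<infinity>"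
    and weak: "\<And>t. 0 < t \<Longrightarrow> ennreal t * emeasure M {x\<in>space M. ennreal t < F x} \<le> ennreal A * emeasure M B"
  shows "(\<integral>\<^sup>+x\<in>B. ennpowr (F x) \<delta> \<partial>M) \<le> ennreal (Kolmogorov_const \<delta> * A powr \<delta>) * emeasure M B"
proof -
  let ?c = "\<lambda>j. 2 powr \<delta> * (2 powr (\<delta> - 1)) ^ j :: real"
  let ?L = "\<lambda>j. {x\<in>space M. ennreal (2 ^ j * A) < F x}"
  have L: "ennreal ((2 ^ Suc j * A) powr \<delta>) * emeasure M (?L j)
      \<le> ennreal (?c j * A powr \<delta>) * emeasure M B" for j
  proof -
    let ?t = "2 ^ j * A"
    have "(2 ^ Suc j * A) powr \<delta> = ?c j * A powr \<delta> / A * ?t"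
    proof -
      have "(2 ^ Suc j * A) powr \<delta> = 2 powr \<delta> * ((2::real) ^ j) powr \<delta> * A powr \<delta>"
        using A by (simp add: powr_mult)
      also have "((2::real) ^ j) powr \<delta> = (2 powr \<delta>) ^ j"
        by (simp add: powr_powr powr_realpow[symmetric] mult.commute)
      also have "(2 powr \<delta>) ^ j = (2 powr (\<delta> - 1)) ^ j * (2::real) ^ j"
        by (simp add: power_mult_distrib[symmetric] powr_diff)
      finally show ?thesis using A by simp
    qed
    then have "ennreal ((2 ^ Suc j * A) powr \<delta>) * emeasure M (?L j)
        = ennreal (?c j * A powr \<delta> / A) * (ennreal ?t * emeasure M (?L j))"
      using A by (simp only: mult.assoc[symmetric], subst ennreal_mult[symmetric]) (auto simp: mult_ac)
    also have "\<dots> \<le> ennreal (?c j * A powr \<delta> / A) * (ennreal A * emeasure M B)"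
      using A by (intro mult_left_mono weak) auto
    also have "\<dots> = ennreal (?c j * A powr \<delta> / A * A) * emeasure M B"
      using A by (simp only: mult.assoc[symmetric], subst ennreal_mult[symmetric]) auto
    finally show ?thesis using A by simp
  qed
  have "(\<integral>\<^sup>+x\<in>B. ennpowr (F x) \<delta> \<partial>M)
      \<le> (\<integral>\<^sup>+x. ennreal (A powr \<delta>) * indicator B x
          + (\<Sum>j. ennreal ((2 ^ Suc j * A) powr \<delta>) * indicator (?L j) x) \<partial>M)"
  proof (intro nn_integral_mono_AE)
    show "AE x in M. ennpowr (F x) \<delta> * indicator B x \<le> ennreal (A powr \<delta>) * indicator B x
          + (\<Sum>j. ennreal ((2 ^ Suc j * A) powr \<delta>) * indicator (?L j) x)"
      using fin AE_space
    proof eventually_elim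
      case (elim x)
      have "indicator (?L j) x = (indicator {t. ennreal (2 ^ j * A) < t} (F x) :: ennreal)" for j
        using elim(2) by (simp add: indicator_def)
      then show ?case
        using ennpowr_le_dyadic_sum[OF A \<delta>(1) elim(1)] by (cases "x \<in> B") simp_all
    qed
  qed
  also have "\<dots> = ennreal (A powr \<delta>) * emeasure M B
      + (\<Sum>j. ennreal ((2 ^ Suc j * A) powr \<delta>) * emeasure M (?L j))"
    by (simp add: nn_integral_add nn_integral_suminf nn_integral_cmult)
  also have "\<dots> \<le> ennreal (A powr \<delta>) * emeasure M B
      + (\<Sum>j. ennreal (?c j * A powr \<delta>) * emeasure M B)"
    by (intro add_left_mono suminf_le L summableI)
  also have "(\<Sum>j. ennreal (?c j * A powr \<delta>) * emeasure M B)
      = ennreal ((Kolmogorov_const \<delta> - 1) * A powr \<delta>) * emeasure M B"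
  proof -
    have "(\<lambda>j. ?c j * A powr \<delta>) sums ((Kolmogorov_const \<delta> - 1) * A powr \<delta>)"
      by (intro sums_mult2 Kolmogorov_const_sum \<delta>)
    then have "(\<Sum>j. ennreal (?c j * A powr \<delta>)) = ennreal ((Kolmogorov_const \<delta> - 1) * A powr \<delta>)"
      by (intro suminf_ennreal_eq) auto
    then show ?thesis by simp
  qed
  also have "ennreal (A powr \<delta>) * emeasure M B + \<dots>
      = ennreal (Kolmogorov_const \<delta> * A powr \<delta>) * emeasure M B"
    using Kolmogorov_const_sum(1)[OF \<delta>(2)] mult_right_mono[of 1 "Kolmogorov_const \<delta>" "A powr \<delta>"]
    by (subst distrib_right[symmetric], subst ennreal_plus[symmetric]) (auto simp: left_diff_distrib)
  finally show ?thesis .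
qed

text \<open>The factor 9^n belongs to the part of h on 3Q: one 3^n is the weak-type constant, the
  other compares the volumes of 3Q and Q. The factor 3^n belongs to the cubes larger than Q, which
  are tripled to reach z.\<close>

definition CR_const :: "nat \<Rightarrow> real \<Rightarrow> real" where
  "CR_const n \<delta> = Kolmogorov_const \<delta> * (9 ^ n) powr \<delta> + (3 ^ n) powr \<delta>"

lemma CR_const_pos: "\<delta> < 1 \<Longrightarrow> 0 < CR_const n \<delta>"
  using Kolmogorov_const_sum(1)[of \<delta>] by (simp add: CR_const_def add_nonneg_pos)

text \<open>Cubes through \<open>x\<close> smaller than \<open>Q = ccube c r\<close> lie in \<open>3Q\<close>; the triples of the larger ones
  contain \<open>Q\<close> and hence \<open>z\<close>.\<close>

lemma MM_le_local_plus_global: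
  fixes h :: "real ^ 'n \<Rightarrow> ennreal"
  assumes h[measurable]: "h \<in> borel_measurable lebesgue" and r: "0 < r"
    and x: "x \<in> ccube c r" and z: "z \<in> ccube c r"
  shows "MM h x \<le> max (MM (\<lambda>y. h y * indicator (ccube c (3 * r)) y) x) (3 ^ CARD('n) * MM h z)"
proof -
  let ?h1 = "\<lambda>y. h y * indicator (ccube c (3 * r)) y"
  let ?\<nu> = "emeasure (density lebesgue h)"
  have "avg (ccube c' r') h \<le> max (MM ?h1 x) (3 ^ CARD('n) * MM h z)"
    if cr: "0 < r'" "x \<in> ccube c' r'" for c' r'
  proof (cases "r' \<le> r")
    case True
    have "ccube c' r' \<subseteq> ccube c (3 * r)" by (rule ccube_triple[OF cr(2) x True])
    then have "avg (ccube c' r') h = avg (ccube c' r') ?h1"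
      unfolding avg_def by (intro arg_cong2[where f = divide] nn_integral_cong refl)
        (auto simp: indicator_def)
    also have "\<dots> \<le> MM ?h1 x"
      unfolding MM_def using cr cube_ccube by (intro SUP_upper) auto
    finally show ?thesis by (simp add: le_max_iff_disj)
  next
    case False
    have "ccube c r \<subseteq> ccube c' (3 * r')" using x cr(2) False by (intro ccube_triple) auto
    then have z': "z \<in> ccube c' (3 * r')" using z by blast
    have "?\<nu> (ccube c' r') \<le> ?\<nu> (ccube c' (3 * r'))"
      by (intro emeasure_mono ccube_triple[OF cr(2) cr(2)]) auto
    also have "\<dots> \<le> MM h z * emeasure lebesgue (ccube c' (3 * r'))"
      using cr(1) z' by (intro emeasure_le_MM h cube_ccube) auto
    also have "\<dots> = 3 ^ CARD('n) * MM h z * emeasure lebesgue (ccube c' r')"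
      using emeasure_ccube_triple[of r' c'] cr(1) by (simp only: less_imp_le mult_ac)
    finally have "avg (ccube c' r') h \<le> 3 ^ CARD('n) * MM h z"
      using cr(1) by (subst avg_le_iff[OF h cube_ccube]) auto
    then show ?thesis by (simp add: le_max_iff_disj)
  qed
  then show ?thesis unfolding MM_def[of h x] by (intro SUP_least) (auto simp: cube_iff)
qed

lemma MM_mono: "(\<And>y. h y \<le> k y) \<Longrightarrow> MM h x \<le> MM k x"
  unfolding MM_def avg_def
  by (intro SUP_mono' divide_right_mono_ennreal nn_integral_mono mult_right_mono) auto

text \<open>As z ranges over Q this is the A_1 inequality. The value A of \<open>MM h\<close> at z
  bounds the average of h over 3Q, so Kolmogorov's inequality controls the near part on Q with 9^n *
  A in place of A; the far part is at most 3^n * A pointwise.\<close>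

lemma Coifman_Rochberg:
  fixes h :: "real ^ 'n \<Rightarrow> ennreal"
  assumes h[measurable]: "h \<in> borel_measurable lebesgue"
    and Q: "cube Q" "z \<in> Q" and \<delta>: "0 < \<delta>" "\<delta> < 1"
    and fin: "AE x in lebesgue. MM h x < \<infinity>" and pos: "0 < MM h z"
  shows "avg Q (\<lambda>x. ennpowr (MM h x) \<delta>) \<le> ennreal (CR_const CARD('n) \<delta>) * ennpowr (MM h z) \<delta>"
proof (cases "MM h z")
  case top
  moreover have "ennreal (CR_const CARD('n) \<delta>) \<noteq> 0"
    using CR_const_pos[OF \<delta>(2), of "CARD('n)"] by (simp add: ennreal_eq_0_iff)
  ultimately show ?thesis by (simp add: ennpowr_def[of top] ennreal_mult_top)
next
  case (real A)
  have A: "0 < A" using pos real by (simp add: ennreal_zero_less_mult_iff)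
  obtain c r where cr: "0 < r" "Q = ccube c r" using Q(1) by (auto simp: cube_iff)
  have [measurable]: "Q \<in> sets lebesgue" using emeasure_cube(3)[OF Q(1)] .
  let ?n = "CARD('n)"
  define h1 where "h1 = (\<lambda>y. h y * indicator (ccube c (3 * r)) y)"
  have h1[measurable]: "h1 \<in> borel_measurable lebesgue" unfolding h1_def by measurable
  let ?\<nu> = "emeasure (density lebesgue h)"
  have "emeasure (density lebesgue h1) UNIV = ?\<nu> (ccube c (3 * r))"
    unfolding h1_def by (simp add: emeasure_density del: nn_integral_completion)
  also have "\<dots> \<le> MM h z * emeasure lebesgue (ccube c (3 * r))"
    using cr Q(2) ccube_triple[of z c r c r] by (intro emeasure_le_MM h cube_ccube) auto
  also have "\<dots> = ennreal (3 ^ ?n * A) * emeasure lebesgue Q"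
    using emeasure_ccube_triple[of r c] cr(1) A unfolding cr(2) real
    by (simp add: ennreal_mult ennreal_power[symmetric] mult_ac del: emeasure_completion)
  finally have mass: "emeasure (density lebesgue h1) UNIV \<le> ennreal (3 ^ ?n * A) * emeasure lebesgue Q" .
  have weak: "ennreal t * emeasure lebesgue {x \<in> space lebesgue. ennreal t < MM h1 x}
      \<le> ennreal (9 ^ ?n * A) * emeasure lebesgue Q" for t
  proof -
    have "ennreal t * emeasure lebesgue {x. ennreal t < MM h1 x}
        \<le> 3 ^ ?n * (ennreal (3 ^ ?n * A) * emeasure lebesgue Q)"
      by (rule order_trans[OF MM_weak_type[OF h1]]) (intro mult_left_mono mass, simp)
    also have "\<dots> = ennreal (3 ^ ?n * (3 ^ ?n * A)) * emeasure lebesgue Q"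
      using A by (subst (2) ennreal_mult) (auto simp: ennreal_power[symmetric] mult.assoc)
    also have "3 ^ ?n * (3 ^ ?n * A) = 9 ^ ?n * A"
      by (simp add: power_mult_distrib[symmetric] mult.assoc[symmetric])
    finally show ?thesis by simp
  qed
  have fin1: "AE x in lebesgue. MM h1 x < \<infinity>"
    using fin
  proof eventually_elim
    case (elim x)
    have "MM h1 x \<le> MM h x" by (rule MM_mono) (simp add: h1_def indicator_def)
    then show ?case using elim by order
  qed
  let ?b = "(3 ^ ?n * A) powr \<delta>"
  have "(\<integral>\<^sup>+x\<in>Q. ennpowr (MM h x) \<delta> \<partial>lebesgue)
      \<le> (\<integral>\<^sup>+x. ennpowr (MM h1 x) \<delta> * indicator Q x + ennreal ?b * indicator Q x \<partial>lebesgue)"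
  proof (intro nn_integral_mono)
    fix x
    show "ennpowr (MM h x) \<delta> * indicator Q x
        \<le> ennpowr (MM h1 x) \<delta> * indicator Q x + ennreal ?b * indicator Q x"
    proof (cases "x \<in> Q")
      case True
      have "MM h x \<le> max (MM h1 x) (3 ^ ?n * MM h z)"
        unfolding h1_def using True Q(2) cr by (intro MM_le_local_plus_global h) auto
      also have "3 ^ ?n * MM h z = ennreal (3 ^ ?n * A)"
        using A by (simp add: real ennreal_mult ennreal_power[symmetric])
      finally have "ennpowr (MM h x) \<delta> \<le> ennpowr (max (MM h1 x) (ennreal (3 ^ ?n * A))) \<delta>"
        using \<delta> by (intro ennpowr_mono) auto
      also have "\<dots> \<le> ennpowr (MM h1 x) \<delta> + ennpowr (ennreal (3 ^ ?n * A)) \<delta>"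
        by (simp add: max_def add_increasing add_increasing2)
      finally show ?thesis using True A by (simp add: ennpowr_ennreal)
    qed simp
  qed
  also have "\<dots> = (\<integral>\<^sup>+x\<in>Q. ennpowr (MM h1 x) \<delta> \<partial>lebesgue) + ennreal ?b * emeasure lebesgue Q"
    by (subst nn_integral_add) (auto simp: nn_integral_cmult_indicator simp del: nn_integral_completion emeasure_completion)
  also have "\<dots> \<le> ennreal (Kolmogorov_const \<delta> * (9 ^ ?n * A) powr \<delta>) * emeasure lebesgue Q
      + ennreal ?b * emeasure lebesgue Q"
    using A by (intro add_right_mono Kolmogorov_inequality weak fin1 \<delta>) auto
  also have "\<dots> = ennreal (CR_const ?n \<delta> * A powr \<delta>) * emeasure lebesgue Q"
    using A Kolmogorov_const_sum(1)[OF \<delta>(2)]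
    by (subst distrib_right[symmetric], subst ennreal_plus[symmetric])
       (auto simp: CR_const_def powr_mult algebra_simps)
  also have "ennreal (CR_const ?n \<delta> * A powr \<delta>) = ennreal (CR_const ?n \<delta>) * ennpowr (MM h z) \<delta>"
    using A CR_const_pos[OF \<delta>(2), of ?n] by (simp add: real ennpowr_ennreal ennreal_mult)
  finally show ?thesis
    by (subst avg_le_iff[OF _ Q(1)])
       (auto simp: emeasure_density simp del: nn_integral_completion emeasure_completion)
qed

subsection \<open>The maximal function as a majorant\<close>

text \<open>A set on which \<open>MM h \<le> a\<close> is covered by nonoverlapping dyadic cubes which meet it and fill little
  more than its measure; each of them carries at most \<open>a\<close> times its volume.  This replaces the
  Lebesgue differentiation theorem.\<close>

lemma emeasure_density_le_of_MM_le:
  fixes h :: "real ^ 'n \<Rightarrow> ennreal"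
  assumes h[measurable]: "h \<in> borel_measurable lebesgue"
    and S[measurable]: "S \<in> sets lebesgue" "bounded S"
    and a: "0 \<le> a" "\<And>x. x \<in> S \<Longrightarrow> MM h x \<le> ennreal a"
  shows "emeasure (density lebesgue h) S \<le> ennreal a * emeasure lebesgue S"
proof (rule ennreal_le_epsilon)
  fix e :: real assume e: "0 < e"
  let ?\<nu> = "emeasure (density lebesgue h)"
  \<comment> \<open>Dividing by a + 1 instead of a also covers a = 0 and still gives a * e' \<le>
    e.\<close>
  define e' where "e' = e / (a + 1)"
  have e': "0 < e'" "a * e' \<le> e" using e a(1) by (auto simp: e'_def field_simps)
  obtain T where T: "open T" "S \<subseteq> T" "T - S \<in> lmeasurable" "emeasure lebesgue (T - S) < ennreal e'"
    using sets_lebesgue_outer_open[OF S(1) e'(1)] by blast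
  obtain R where R: "0 < R" "\<And>x. x \<in> S \<Longrightarrow> norm x \<le> R"
    using S(2) by (auto simp: bounded_pos)
  have SR: "S \<subseteq> ccube 0 R"
  using R(2) by (auto intro: norm_le_mem_ccube)
  let ?l = "0 - (\<chi> i. R) :: real ^ 'n" and ?r = "0 + (\<chi> i. R) :: real ^ 'n"
  have "0 \<in> ocube (0 :: real ^ 'n) R" using R(1) by (simp add: mem_ocube)
  then have ne: "box ?l ?r \<noteq> {}" unfolding ocube_def by blast
  \<comment> \<open>With this gauge every covering cube, being tagged by a point of S, is contained
    in T.\<close>
  have g: "gauge (\<lambda>x. if x \<in> T then T else UNIV)" using T(1) by (auto simp: gauge_def)
  obtain D where D: "countable D" "\<Union>D \<subseteq> cbox ?l ?r"
    "\<And>K. K \<in> D \<Longrightarrow> interior K \<noteq> {} \<and> (\<exists>c d. K = cbox c d)"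
    "pairwise (\<lambda>A B. interior A \<inter> interior B = {}) D"
    "\<And>K. K \<in> D \<Longrightarrow> \<exists>x\<in>S \<inter> K. K \<subseteq> (if x \<in> T then T else UNIV)"
    "\<And>c d. cbox c d \<in> D \<Longrightarrow> \<exists>n. \<forall>i\<in>Basis. d \<bullet> i - c \<bullet> i = (?r \<bullet> i - ?l \<bullet> i) / 2 ^ n"
    "S \<subseteq> \<Union>D"
    by (rule covering_lemma[OF SR[unfolded ccube_def] ne g]) blast
  have K: "?\<nu> (interior K) \<le> ennreal a * emeasure lebesgue (interior K)"
    "K - interior K \<in> null_sets lebesgue" "interior K \<subseteq> T" if KD: "K \<in> D" for K
  proof -
    obtain c d where cd: "K = cbox c d" using D(3)[OF KD] by blast
    obtain x where x: "x \<in> S" "x \<in> K" "K \<subseteq> T" using D(5)[OF KD] T(2) by auto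
    then show "interior K \<subseteq> T" using interior_subset by blast
    obtain n where n: "\<forall>i\<in>Basis. d \<bullet> i - c \<bullet> i = (?r \<bullet> i - ?l \<bullet> i) / 2 ^ n"
      using D(6)[OF KD[unfolded cd]] by (elim exE)
    \<comment> \<open>The ambient box is a cube, so its dyadic pieces have equal edges; only then
      does the maximal function control their averages.\<close>
    have "d $ j - c $ j = 2 * R / 2 ^ n" for j
      using n[rule_format, of "axis j 1"] by (simp add: inner_axis axis_in_Basis_iff)
    then have "d $ j = c $ j + 2 * R / 2 ^ n" for j
      by (simp add: diff_eq_eq add.commute)
    then have "d = c + (\<chi> j. 2 * R / 2 ^ n)" by (simp add: vec_eq_iff)
    then have cube: "cube K" unfolding cube_def cd using R(1) by (intro exI[of _ c] exI[of _ "2 * R / 2 ^ n"]) simp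
    show null: "K - interior K \<in> null_sets lebesgue"
      unfolding cd interior_cbox negligible_iff_null_sets[symmetric]
      by (rule negligible_frontier_interval)
    have "?\<nu> (interior K) \<le> ?\<nu> K"
      by (intro emeasure_mono interior_subset) (auto simp: cd)
    also have "\<dots> \<le> MM h x * emeasure lebesgue K" by (intro emeasure_le_MM h cube x)
    also have "\<dots> \<le> ennreal a * emeasure lebesgue K" by (intro mult_right_mono a x) simp
    also have "emeasure lebesgue K = emeasure lebesgue (interior K)"
    proof -
      have "emeasure lebesgue (interior K \<union> (K - interior K)) = emeasure lebesgue (interior K)"
        by (intro emeasure_Un_null_set null) (auto simp: cd interior_cbox)
      moreover have "interior K \<union> (K - interior K) = K" using interior_subset by blast
      ultimately show ?thesis by simp
    qed
    finally show "?\<nu> (interior K) \<le> ennreal a * emeasure lebesgue (interior K)" .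
  qed
  \<comment> \<open>Only the interiors are disjoint, so additivity is applied to them. The
    boundaries are Lebesgue null, hence null for the density as well.\<close>
  have disj: "disjoint_family_on interior D"
    using D(4) by (auto simp: disjoint_family_on_def pairwise_def)
  have int: "interior K \<in> sets lebesgue" if "K \<in> D" for K
    using D(3)[OF that] by (auto simp: interior_cbox)
  have sets: "(\<Union>K\<in>D. interior K) \<in> sets lebesgue"
    using D(1) int by (intro sets.countable_UN'') auto
  have N: "(\<Union>K\<in>D. K - interior K) \<in> null_sets lebesgue"
    using D(1) K(2) by (intro null_sets_UN') auto
  have N\<nu>: "(\<Union>K\<in>D. K - interior K) \<in> null_sets (density lebesgue h)"
    using N by (auto simp: null_sets_density_iff[OF h] intro!: AE_I'[OF N])
  have "?\<nu> S \<le> ?\<nu> ((\<Union>K\<in>D. interior K) \<union> (\<Union>K\<in>D. K - interior K))"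
    using D(7) sets N by (intro emeasure_mono) auto
  also have "\<dots> = ?\<nu> (\<Union>K\<in>D. interior K)"
    using sets by (intro emeasure_Un_null_set N\<nu>) auto
  also have "\<dots> = (\<integral>\<^sup>+K. ?\<nu> (interior K) \<partial>count_space D)"
    using int D(1) disj by (intro emeasure_UN_countable) auto
  also have "\<dots> \<le> (\<integral>\<^sup>+K. ennreal a * emeasure lebesgue (interior K) \<partial>count_space D)"
    using K(1) by (intro nn_integral_mono) auto
  also have "\<dots> = ennreal a * (\<integral>\<^sup>+K. emeasure lebesgue (interior K) \<partial>count_space D)"
    by (intro nn_integral_cmult) auto
  also have "(\<integral>\<^sup>+K. emeasure lebesgue (interior K) \<partial>count_space D) = emeasure lebesgue (\<Union>K\<in>D. interior K)"
    using int D(1) disj by (intro emeasure_UN_countable[symmetric]) auto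
  also have "ennreal a * \<dots> \<le> ennreal a * emeasure lebesgue T"
    using K(3) T(1) by (intro mult_left_mono emeasure_mono) auto
  also have "\<dots> \<le> ennreal a * (emeasure lebesgue S + emeasure lebesgue (T - S))"
  proof (rule mult_left_mono)
    have "S \<union> (T - S) = T" using T(2) by blast
    then show "emeasure lebesgue T \<le> emeasure lebesgue S + emeasure lebesgue (T - S)"
      using emeasure_subadditive[of S lebesgue "T - S"] S(1) T(3) by auto
  qed simp
  also have "\<dots> \<le> ennreal a * emeasure lebesgue S + ennreal a * ennreal e'"
    unfolding distrib_left using T(4) by (intro add_left_mono mult_left_mono) auto
  also have "\<dots> \<le> ennreal a * emeasure lebesgue S + ennreal e"
  proof (rule add_left_mono)
    show "ennreal a * ennreal e' \<le> ennreal e"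
      using e' a(1) by (subst ennreal_mult[symmetric]) (auto intro: ennreal_leI)
  qed
  finally show "?\<nu> S \<le> ennreal a * emeasure lebesgue S + ennreal e" .
qed

text \<open>Where the inequality fails, two rationals a < b separate \<open>MM h x\<close> from
  \<open>h x\<close>. On a bounded set N of such points b * |N| \<le> mass of N \<le> a * |N| with
  |N| finite, so N is null; countably many such sets exhaust the failures.\<close>

lemma AE_le_MM:
  fixes h :: "real ^ 'n \<Rightarrow> ennreal"
  assumes h[measurable]: "h \<in> borel_measurable lebesgue"
  shows "AE x in lebesgue. h x \<le> MM h x"
proof -
  define N where "N = (\<lambda>a b m. {x \<in> ccube 0 (real m). MM h x \<le> ennreal (real_of_rat a) \<and>
    ennreal (real_of_rat b) < h x})"
  have N: "N a b m \<in> null_sets lebesgue" if ab: "0 \<le> a" "a < b" for a b m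
  proof -
    let ?S = "N a b m"
    have sets[measurable]: "?S \<in> sets lebesgue"
    proof -
      have "?S = ccube 0 (real m) \<inter> {x \<in> space lebesgue. MM h x \<le> ennreal (real_of_rat a) \<and>
          ennreal (real_of_rat b) < h x}"
        by (auto simp: N_def)
      also have "\<dots> \<in> sets lebesgue"
        by (intro sets.Int sets_ccube) measurable
      finally show ?thesis .
    qed
    have sub: "?S \<subseteq> ccube 0 (real m)" by (auto simp: N_def)
    have bdd: "bounded ?S"
      by (rule bounded_subset[OF _ sub]) (simp add: ccube_def)
    have fin: "emeasure lebesgue ?S < \<infinity>"
      using bounded_set_imp_lmeasurable[OF bdd sets] by (auto simp: fmeasurable_def)
    then obtain s where s: "0 \<le> s" "emeasure lebesgue ?S = ennreal s"
      by (cases "emeasure lebesgue ?S") auto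
    have "ennreal (real_of_rat b) * emeasure lebesgue ?S
        = (\<integral>\<^sup>+x. ennreal (real_of_rat b) * indicator ?S x \<partial>lebesgue)"
      by (simp add: nn_integral_cmult_indicator del: emeasure_completion nn_integral_completion)
    also have "\<dots> \<le> (\<integral>\<^sup>+x. h x * indicator ?S x \<partial>lebesgue)"
      by (intro nn_integral_mono) (auto simp: N_def indicator_def)
    also have "\<dots> = emeasure (density lebesgue h) ?S"
      by (simp add: emeasure_density del: nn_integral_completion)
    also have "\<dots> \<le> ennreal (real_of_rat a) * emeasure lebesgue ?S"
      using ab(1) by (intro emeasure_density_le_of_MM_le h sets bdd) (auto simp: N_def)
    finally have "real_of_rat b * s \<le> real_of_rat a * s"
      using ab s by (simp add: ennreal_mult[symmetric])
    then have "s = 0" using ab(2) s(1) by (auto simp: mult_le_cancel_right of_rat_less_eq)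
    then show ?thesis using s sets by (auto simp: null_sets_def)
  qed
  have "AE x in lebesgue. \<forall>a b m. 0 \<le> a \<longrightarrow> a < b \<longrightarrow> x \<notin> N a b m"
  proof (unfold AE_all_countable, intro allI)
    fix a b m
    show "AE x in lebesgue. 0 \<le> a \<longrightarrow> a < b \<longrightarrow> x \<notin> N a b m"
      by (cases "0 \<le> a \<and> a < b") (use AE_not_in[OF N] in auto)
  qed
  then show ?thesis
  proof eventually_elim
    case (elim x)
    show "h x \<le> MM h x"
    proof (rule ccontr)
      assume "\<not> h x \<le> MM h x"
      then have "MM h x < h x" by simp
      then obtain b where b: "MM h x < ennreal (real_of_rat b)" "ennreal (real_of_rat b) < h x"
        using ennreal_rat_dense by blast
      then obtain a where a: "MM h x < ennreal (real_of_rat a)" "ennreal (real_of_rat a) < ennreal (real_of_rat b)"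
        using ennreal_rat_dense by blast
      have "0 < real_of_rat a" using a(1) by (metis ennreal_neg not_less_zero not_le)
      then have a0: "0 \<le> a" "a < b" using a(2) by (auto simp: ennreal_less_iff of_rat_less)
      obtain m where m: "norm x \<le> real m" using real_arch_simple by blast
      then have "x \<in> ccube 0 (real m)" by (intro norm_le_mem_ccube) simp
      then have "x \<in> N a b m" using a b by (auto simp: N_def)
      then show False using elim a0 by blast
    qed
  qed
qed

subsection \<open>Hoelder's inequality\<close>

text \<open>Young's inequality for F/s and G/t, integrated. Positive bounds s and t in place of the
  norms themselves avoid the cases of norm zero or infinity.\<close>

lemma Holder_nn_integral:
  fixes F G :: "'a \<Rightarrow> real"
  assumes [measurable]: "F \<in> borel_measurable M" "G \<in> borel_measurable M"
    and nn: "\<And>x. 0 \<le> F x" "\<And>x. 0 \<le> G x"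
    and p: "1 < p" "1 < p'" "1 / p + 1 / p' = 1" and st: "0 < s" "0 < t"
    and F: "(\<integral>\<^sup>+x. ennreal (F x powr p) \<partial>M) \<le> ennreal (s powr p)"
    and G: "(\<integral>\<^sup>+x. ennreal (G x powr p') \<partial>M) \<le> ennreal (t powr p')"
  shows "(\<integral>\<^sup>+x. ennreal (F x * G x) \<partial>M) \<le> ennreal (s * t)"
proof -
  have pt: "F x * G x \<le> s * t / p / (s powr p) * F x powr p + s * t / p' / (t powr p') * G x powr p'" for x
  proof -
    have "(F x / s) * (G x / t) \<le> (F x / s) powr p / p + (G x / t) powr p' / p'"
      using nn st p by (intro Youngs_inequality) auto
    then have "s * t * ((F x / s) * (G x / t)) \<le> s * t * ((F x / s) powr p / p + (G x / t) powr p' / p')"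
      using st by (intro mult_left_mono) auto
    then show ?thesis using st nn by (simp add: powr_divide algebra_simps)
  qed
  have "(\<integral>\<^sup>+x. ennreal (F x * G x) \<partial>M)
      \<le> (\<integral>\<^sup>+x. ennreal (s * t / p / (s powr p)) * ennreal (F x powr p)
          + ennreal (s * t / p' / (t powr p')) * ennreal (G x powr p') \<partial>M)"
  proof (intro nn_integral_mono)
    fix x
    have "ennreal (F x * G x) \<le> ennreal (s * t / p / (s powr p) * F x powr p + s * t / p' / (t powr p') * G x powr p')"
      by (intro ennreal_leI pt)
    also have "\<dots> = ennreal (s * t / p / (s powr p)) * ennreal (F x powr p)
          + ennreal (s * t / p' / (t powr p')) * ennreal (G x powr p')"
      using st p by (subst ennreal_plus) (auto simp: ennreal_mult[symmetric])
    finally show "ennreal (F x * G x) \<le> \<dots>" .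
  qed
  also have "\<dots> = ennreal (s * t / p / (s powr p)) * (\<integral>\<^sup>+x. ennreal (F x powr p) \<partial>M)
      + ennreal (s * t / p' / (t powr p')) * (\<integral>\<^sup>+x. ennreal (G x powr p') \<partial>M)"
    by (simp add: nn_integral_add nn_integral_cmult)
  also have "\<dots> \<le> ennreal (s * t / p / (s powr p)) * ennreal (s powr p)
      + ennreal (s * t / p' / (t powr p')) * ennreal (t powr p')"
    by (intro add_mono mult_left_mono F G) auto
  also have "\<dots> = ennreal (s * t / p + s * t / p')"
    using st p by (simp add: ennreal_mult[symmetric])
  also have "s * t / p + s * t / p' = s * t"
    using p(3) by (metis distrib_left divide_inverse inverse_eq_divide mult.right_neutral)
  finally show ?thesis .
qed

subsection \<open>Products of \<open>A\<^sub>1\<close> weights\<close>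

lemma not_AE_notin_cube: "cube Q \<Longrightarrow> \<not> (AE x in lebesgue. x \<notin> Q)"
  using emeasure_cube[of Q] AE_iff_null_sets[of Q lebesgue] by (auto simp del: emeasure_completion)

lemma nn_integral_pos:
  assumes [measurable]: "F \<in> borel_measurable M" "E \<in> sets M"
    and "\<And>x. x \<in> E \<Longrightarrow> 0 < F x" "\<not> (AE x in M. x \<notin> E)"
  shows "0 < (\<integral>\<^sup>+x. F x \<partial>M)"
proof (rule ccontr)
  assume "\<not> 0 < (\<integral>\<^sup>+x. F x \<partial>M)"
  then have "AE x in M. F x = 0" by (simp add: nn_integral_0_iff_AE)
  then have "AE x in M. x \<notin> E" by eventually_elim (use assms(3) in fastforce)
  then show False using assms(4) by blast
qed

lemma avg_le_cmult:
  assumes [measurable]: "k \<in> borel_measurable lebesgue" "Q \<in> sets lebesgue"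
    and "AE x in lebesgue. x \<in> Q \<longrightarrow> h x \<le> c * k x"
  shows "avg Q h \<le> c * avg Q k"
proof -
  have "(\<integral>\<^sup>+x\<in>Q. h x \<partial>lebesgue) \<le> (\<integral>\<^sup>+x. c * (k x * indicator Q x) \<partial>lebesgue)"
    using assms(3) by (intro nn_integral_mono_AE, eventually_elim) (auto simp: indicator_def)
  also have "\<dots> = c * (\<integral>\<^sup>+x\<in>Q. k x \<partial>lebesgue)"
    by (intro nn_integral_cmult) measurable
  finally show ?thesis
    unfolding avg_def ennreal_times_divide by (rule divide_right_mono_ennreal)
qed

lemma avg_cong_AE:
  assumes "AE x in lebesgue. h x = k x"
  shows "avg Q h = avg Q k"
proof -
  have "AE x in lebesgue. h x * indicator Q x = k x * indicator Q x"
    using assms by eventually_elim simp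
  then show ?thesis
    unfolding avg_def by (intro arg_cong2[where f = divide] nn_integral_cong_AE refl)
qed

lemma nn_integral_le_avg:
  assumes "h \<in> borel_measurable lebesgue" "cube Q" "avg Q h \<le> t"
  shows "(\<integral>\<^sup>+x\<in>Q. h x \<partial>lebesgue) \<le> t * emeasure lebesgue Q"
  using avg_le_iff[OF assms(1,2), of t] assms emeasure_cube(3)[OF assms(2)]
  by (simp add: emeasure_density del: nn_integral_completion emeasure_completion)

text \<open>The number \<open>m\<close> replaces the essential infimum of \<open>H\<close> on \<open>Q\<close>, so \<open>C\<close> bounds
  the \<open>A\<^sub>1\<close> constant of \<open>H\<close>.\<close>

definition A1_bound :: "real \<Rightarrow> (real ^ 'n \<Rightarrow> real) \<Rightarrow> bool" where
  "A1_bound C H \<longleftrightarrow> H \<in> borel_measurable lebesgue \<and> (\<forall>x. 0 < H x) \<and>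
     (\<forall>Q. cube Q \<longrightarrow> (\<exists>m>0. avg Q (\<lambda>x. ennreal (H x)) \<le> ennreal (C * m) \<and>
        (AE x in lebesgue. x \<in> Q \<longrightarrow> m \<le> H x)))"

text \<open>The value 1 on the null set where the maximal function is infinite keeps the weight finite
  and positive everywhere.\<close>

definition maximal_power :: "(real ^ 'n \<Rightarrow> ennreal) \<Rightarrow> real \<Rightarrow> real ^ 'n \<Rightarrow> real" where
  "maximal_power h \<delta> x = (if MM h x = \<infinity> then 1 else enn2real (MM h x) powr \<delta>)"

lemma ennreal_maximal_power: "MM h x < \<infinity> \<Longrightarrow> ennreal (maximal_power h \<delta> x) = ennpowr (MM h x) \<delta>"
  by (auto simp: maximal_power_def ennpowr_def)

text \<open>Coifman-Rochberg says that the average over Q is at most C times the value at every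
  point of Q where the maximal function is finite. So average / C serves as the lower bound
  m.\<close>

lemma A1_bound_maximal_power:
  fixes h :: "real ^ 'n \<Rightarrow> ennreal"
  assumes h[measurable]: "h \<in> borel_measurable lebesgue" and \<delta>: "0 < \<delta>" "\<delta> < 1"
    and fin: "AE x in lebesgue. MM h x < \<infinity>" and pos: "0 < (\<integral>\<^sup>+x. h x \<partial>lebesgue)"
  shows "A1_bound (CR_const CARD('n) \<delta>) (maximal_power h \<delta>)"
  unfolding A1_bound_def
proof (intro conjI allI impI)
  let ?H = "maximal_power h \<delta>" and ?C = "CR_const CARD('n) \<delta>"
  have C: "0 < ?C" by (rule CR_const_pos[OF \<delta>(2)])
  show meas[measurable]: "?H \<in> borel_measurable lebesgue"
    unfolding maximal_power_def by measurable
  show Hpos: "0 < ?H x" for x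
    using MM_pos[OF h pos, of x] enn2real_positive_iff[of "MM h x"]
    by (auto simp: maximal_power_def less_top)
  fix Q :: "(real ^ 'n) set" assume Q: "cube Q"
  let ?\<alpha> = "avg Q (\<lambda>x. ennreal (?H x))"
  have eq: "?\<alpha> = avg Q (\<lambda>x. ennpowr (MM h x) \<delta>)"
    using fin by (intro avg_cong_AE, eventually_elim) (rule ennreal_maximal_power)
  have le: "?\<alpha> \<le> ennreal (?C * ?H x)" if "x \<in> Q" "MM h x < \<infinity>" for x
  proof -
    have "?\<alpha> \<le> ennreal ?C * ennpowr (MM h x) \<delta>"
      unfolding eq by (intro Coifman_Rochberg h Q that \<delta> fin MM_pos pos)
    then show ?thesis
      using C Hpos[of x] by (simp add: ennreal_maximal_power[OF that(2), symmetric] ennreal_mult)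
  qed
  \<comment> \<open>One such point already makes the average finite.\<close>
  have "\<exists>z\<in>Q. MM h z < \<infinity>"
  proof (rule ccontr)
    assume "\<not> ?thesis"
    then have "x \<notin> Q" if "MM h x < \<infinity>" for x using that by blast
    then have "AE x in lebesgue. x \<notin> Q" using fin by (auto elim: eventually_mono)
    then show False using not_AE_notin_cube[OF Q] by blast
  qed
  then have "?\<alpha> < \<infinity>" using le by (metis ennreal_less_top infinity_ennreal_def le_less_trans)
  then obtain a where a: "0 \<le> a" "?\<alpha> = ennreal a" by (cases ?\<alpha>) auto
  have "0 < (\<integral>\<^sup>+x\<in>Q. ennreal (?H x) \<partial>lebesgue)"
    using emeasure_cube(3)[OF Q] Hpos not_AE_notin_cube[OF Q]
    by (intro nn_integral_pos[where E = Q]) auto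
  then have "?\<alpha> \<noteq> 0"
    unfolding avg_def using emeasure_cube(2)[OF Q] by (auto simp: ennreal_divide_eq_0_iff)
  then have a0: "0 < a" using a by (cases "a = 0") auto
  show "\<exists>m>0. ?\<alpha> \<le> ennreal (?C * m) \<and> (AE x in lebesgue. x \<in> Q \<longrightarrow> m \<le> ?H x)"
  proof (intro exI[of _ "a / ?C"] conjI)
    show "0 < a / ?C" using a0 C by simp
    show "?\<alpha> \<le> ennreal (?C * (a / ?C))" using a C by simp
    show "AE x in lebesgue. x \<in> Q \<longrightarrow> a / ?C \<le> ?H x"
      using fin
    proof (eventually_elim, intro impI)
      fix x assume "MM h x < \<infinity>" "x \<in> Q"
      then have "ennreal a \<le> ennreal (?C * ?H x)" using le a(2) by simp
      then have "a \<le> ?C * ?H x" using C Hpos[of x] by (simp add: ennreal_le_iff)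
      then show "a / ?C \<le> ?H x" using C by (simp add: divide_le_eq mult.commute)
    qed
  qed
qed

text \<open>The easy half of the factorization of A_p weights. As 1 - p0 \<le> 0, the lower bound m2
  for H2 leaves an average of H1; in the dual power of w the factor H2 appears with exponent 1 and
  H1 with a negative one, so the roles are exchanged. Both estimates must share m1 and m2, which is
  why these are handed out together.\<close>

lemma A1_product_avg:
  fixes H1 H2 :: "real ^ 'n \<Rightarrow> real"
  assumes p0: "1 \<le> p0" and C: "0 < C1" "0 < C2"
    and H1: "A1_bound C1 H1" and H2: "A1_bound C2 H2" and Q: "cube Q"
  defines "w \<equiv> \<lambda>x. H1 x * H2 x powr (1 - p0)"
  obtains m1 m2 where "0 < m1" "0 < m2" "AE x in lebesgue. x \<in> Q \<longrightarrow> m1 \<le> H1 x"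
    "avg Q (\<lambda>x. ennreal (w x)) \<le> ennreal (C1 * m1 * m2 powr (1 - p0))"
    "1 < p0 \<Longrightarrow> avg Q (\<lambda>x. ennreal (w x powr (- 1 / (p0 - 1)))) \<le> ennreal (m1 powr (- 1 / (p0 - 1)) * (C2 * m2))"
proof -
  have [measurable]: "H1 \<in> borel_measurable lebesgue" "H2 \<in> borel_measurable lebesgue"
    and pos: "\<And>x. 0 < H1 x" "\<And>x. 0 < H2 x"
    using H1 H2 by (auto simp: A1_bound_def)
  have [measurable]: "Q \<in> sets lebesgue" using emeasure_cube(3)[OF Q] .
  obtain m1 where m1: "0 < m1" "avg Q (\<lambda>x. ennreal (H1 x)) \<le> ennreal (C1 * m1)"
    "AE x in lebesgue. x \<in> Q \<longrightarrow> m1 \<le> H1 x"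
    using H1 Q unfolding A1_bound_def by blast
  obtain m2 where m2: "0 < m2" "avg Q (\<lambda>x. ennreal (H2 x)) \<le> ennreal (C2 * m2)"
    "AE x in lebesgue. x \<in> Q \<longrightarrow> m2 \<le> H2 x"
    using H2 Q unfolding A1_bound_def by blast
  have "avg Q (\<lambda>x. ennreal (w x)) \<le> ennreal (m2 powr (1 - p0)) * avg Q (\<lambda>x. ennreal (H1 x))"
  proof (rule avg_le_cmult)
    show "AE x in lebesgue. x \<in> Q \<longrightarrow> ennreal (w x) \<le> ennreal (m2 powr (1 - p0)) * ennreal (H1 x)"
      using m2(3)
    proof (eventually_elim, intro impI)
      fix x assume "x \<in> Q \<longrightarrow> m2 \<le> H2 x" "x \<in> Q"
      then have "H2 x powr (1 - p0) \<le> m2 powr (1 - p0)"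
        using m2(1) p0 by (intro powr_mono2') auto
      then have "w x \<le> m2 powr (1 - p0) * H1 x"
        unfolding w_def using pos(1)[of x] by (simp add: mult.commute mult_right_mono)
      then show "ennreal (w x) \<le> ennreal (m2 powr (1 - p0)) * ennreal (H1 x)"
        using pos(1)[of x] by (simp add: ennreal_mult[symmetric] less_imp_le ennreal_leI)
    qed
  qed measurable
  also have "\<dots> \<le> ennreal (m2 powr (1 - p0)) * ennreal (C1 * m1)"
    by (intro mult_left_mono m1) simp
  also have "\<dots> = ennreal (C1 * m1 * m2 powr (1 - p0))"
    using C m1(1) by (subst ennreal_mult[symmetric]) (auto simp: mult_ac)
  finally have 1: "avg Q (\<lambda>x. ennreal (w x)) \<le> ennreal (C1 * m1 * m2 powr (1 - p0))" .
  have 2: "avg Q (\<lambda>x. ennreal (w x powr (- 1 / (p0 - 1)))) \<le> ennreal (m1 powr (- 1 / (p0 - 1)) * (C2 * m2))"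
    if p: "1 < p0"
  proof -
    let ?a = "- 1 / (p0 - 1)"
    have "avg Q (\<lambda>x. ennreal (w x powr ?a)) \<le> ennreal (m1 powr ?a) * avg Q (\<lambda>x. ennreal (H2 x))"
    proof (rule avg_le_cmult)
      show "AE x in lebesgue. x \<in> Q \<longrightarrow> ennreal (w x powr ?a) \<le> ennreal (m1 powr ?a) * ennreal (H2 x)"
        using m1(3)
      proof (eventually_elim, intro impI)
        fix x assume x: "x \<in> Q \<longrightarrow> m1 \<le> H1 x" "x \<in> Q"
        have "(1 - p0) * ?a = 1" using p by (simp add: field_simps)
        then have "w x powr ?a = H1 x powr ?a * H2 x"
          unfolding w_def using pos[of x] by (simp add: powr_mult powr_powr del: times_divide_eq_right)
        also have "\<dots> \<le> m1 powr ?a * H2 x"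
          using x m1(1) p pos(2)[of x] by (intro mult_right_mono powr_mono2') (auto simp: divide_le_0_iff)
        finally show "ennreal (w x powr ?a) \<le> ennreal (m1 powr ?a) * ennreal (H2 x)"
          using pos(2)[of x] by (simp add: ennreal_mult[symmetric] less_imp_le ennreal_leI)
      qed
    qed measurable
    also have "\<dots> \<le> ennreal (m1 powr ?a) * ennreal (C2 * m2)"
      by (intro mult_left_mono m2) simp
    also have "\<dots> = ennreal (m1 powr ?a * (C2 * m2))"
      using C m2(1) by (subst ennreal_mult[symmetric]) auto
    finally show ?thesis .
  qed
  show ?thesis by (rule that[OF m1(1) m2(1) m1(3) 1 2])
qed

text \<open>In the product of the two averages m1 cancels against 1/m1 and m2^(1-p0) against
  m2^(p0-1), so a constant free of Q remains. For p0 = 1 the essential supremum of 1/w supplies the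
  factor 1/m1.\<close>

lemma A1_product_Ap_const:
  fixes H1 H2 :: "real ^ 'n \<Rightarrow> real"
  assumes p0: "1 \<le> p0" and C: "0 < C1" "0 < C2"
    and H1: "A1_bound C1 H1" and H2: "A1_bound C2 H2"
  shows "Ap_const p0 (\<lambda>x. H1 x * H2 x powr (1 - p0)) \<le> ennreal (C1 * C2 powr (p0 - 1))"
proof -
  let ?w = "\<lambda>x. H1 x * H2 x powr (1 - p0)"
  have [measurable]: "H1 \<in> borel_measurable lebesgue" "H2 \<in> borel_measurable lebesgue"
    and pos: "\<And>x. 0 < H1 x" "\<And>x. 0 < H2 x"
    using H1 H2 by (auto simp: A1_bound_def)
  show ?thesis
  proof (cases "p0 = 1")
    case True
    have "avg Q (\<lambda>x. ennreal (?w x)) * esssup (lebesgue_on Q) (\<lambda>x. ennreal (inverse (?w x)))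
        \<le> ennreal C1" if Q: "cube Q" for Q
    proof -
      obtain m1 m2 where m: "0 < m1" "0 < m2" "AE x in lebesgue. x \<in> Q \<longrightarrow> m1 \<le> H1 x"
        "avg Q (\<lambda>x. ennreal (?w x)) \<le> ennreal (C1 * m1 * m2 powr (1 - p0))"
        by (rule A1_product_avg[OF p0 C H1 H2 Q])
      have "esssup (lebesgue_on Q) (\<lambda>x. ennreal (inverse (?w x))) \<le> ennreal (inverse m1)"
      proof (rule esssup_I)
        show "(\<lambda>x. ennreal (inverse (?w x))) \<in> borel_measurable (lebesgue_on Q)"
          by (intro measurable_restrict_space1) measurable
        have "AE x in lebesgue. x \<in> Q \<longrightarrow> ennreal (inverse (?w x)) \<le> ennreal (inverse m1)"
          using m(3)
        proof eventually_elim
          case (elim x)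
          then show ?case using m(1) pos[of x] True by (auto intro!: ennreal_leI le_imp_inverse_le)
        qed
        then show "AE x in lebesgue_on Q. ennreal (inverse (?w x)) \<le> ennreal (inverse m1)"
          using emeasure_cube(3)[OF Q] by (subst AE_restrict_space_iff) auto
      qed
      then have "avg Q (\<lambda>x. ennreal (?w x)) * esssup (lebesgue_on Q) (\<lambda>x. ennreal (inverse (?w x)))
          \<le> ennreal (C1 * m1 * m2 powr (1 - p0)) * ennreal (inverse m1)"
        by (intro mult_mono m) auto
      also have "\<dots> = ennreal C1"
        using True m C by (subst ennreal_mult[symmetric]) auto
      finally show ?thesis .
    qed
    then show ?thesis
      unfolding Ap_const_def using True C by (auto intro!: SUP_least)
  next
    case False
    then have p: "1 < p0" using p0 by simp
    let ?a = "- 1 / (p0 - 1)"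
    have "avg Q (\<lambda>x. ennreal (?w x)) * ennpowr (avg Q (\<lambda>x. ennreal (?w x powr ?a))) (p0 - 1)
        \<le> ennreal (C1 * C2 powr (p0 - 1))" if Q: "cube Q" for Q
    proof -
      obtain m1 m2 where m: "0 < m1" "0 < m2"
        "avg Q (\<lambda>x. ennreal (?w x)) \<le> ennreal (C1 * m1 * m2 powr (1 - p0))"
        "avg Q (\<lambda>x. ennreal (?w x powr ?a)) \<le> ennreal (m1 powr ?a * (C2 * m2))"
        using p by (blast intro: A1_product_avg[OF p0 C H1 H2 Q])
      have "ennpowr (avg Q (\<lambda>x. ennreal (?w x powr ?a))) (p0 - 1)
          \<le> ennpowr (ennreal (m1 powr ?a * (C2 * m2))) (p0 - 1)"
        using p by (intro ennpowr_mono m) auto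
      also have "\<dots> = ennreal ((m1 powr ?a * (C2 * m2)) powr (p0 - 1))"
        using m C by (intro ennpowr_ennreal) auto
      also have "(m1 powr ?a * (C2 * m2)) powr (p0 - 1) = C2 powr (p0 - 1) * m2 powr (p0 - 1) / m1"
      proof -
        have "?a * (p0 - 1) = -1" using p by simp
        then have 1: "(m1 powr ?a) powr (p0 - 1) = inverse m1"
          unfolding powr_powr using m(1) by (simp add: powr_minus)
        have "(m1 powr ?a * (C2 * m2)) powr (p0 - 1)
            = (m1 powr ?a) powr (p0 - 1) * (C2 powr (p0 - 1) * m2 powr (p0 - 1))"
          using m C by (simp only: powr_mult)
        then show ?thesis unfolding 1 by (simp add: divide_inverse mult_ac)
      qed
      finally have "avg Q (\<lambda>x. ennreal (?w x)) * ennpowr (avg Q (\<lambda>x. ennreal (?w x powr ?a))) (p0 - 1)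
          \<le> ennreal (C1 * m1 * m2 powr (1 - p0)) * ennreal (C2 powr (p0 - 1) * m2 powr (p0 - 1) / m1)"
        by (intro mult_mono m) auto
      also have "\<dots> = ennreal (C1 * C2 powr (p0 - 1) * (m2 powr (1 - p0) * m2 powr (p0 - 1)))"
        using m C by (subst ennreal_mult[symmetric]) (auto simp: mult_ac)
      also have "m2 powr (1 - p0) * m2 powr (p0 - 1) = 1"
        using m by (simp add: powr_add[symmetric])
      finally show ?thesis by simp
    qed
    then show ?thesis
      unfolding Ap_const_def using False by (auto intro!: SUP_least)
  qed
qed

text \<open>Local integrability holds because a compact set sits in a cube, over which the average
  is finite.\<close>

lemma A1_product_weight:
  fixes H1 H2 :: "real ^ 'n \<Rightarrow> real"
  assumes p0: "1 \<le> p0" and C: "0 < C1" "0 < C2"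
    and H1: "A1_bound C1 H1" and H2: "A1_bound C2 H2"
  shows "weight (\<lambda>x. H1 x * H2 x powr (1 - p0))"
proof -
  let ?w = "\<lambda>x. H1 x * H2 x powr (1 - p0)"
  have [measurable]: "H1 \<in> borel_measurable lebesgue" "H2 \<in> borel_measurable lebesgue"
    and pos: "\<And>x. 0 < H1 x" "\<And>x. 0 < H2 x"
    using H1 H2 by (auto simp: A1_bound_def)
  have w: "0 < ?w x" for x using pos[of x] by simp
  have "set_integrable lebesgue K ?w" if K: "compact K" for K
  proof -
    obtain R where R: "0 < R" "\<And>x. x \<in> K \<Longrightarrow> norm x \<le> R"
      using compact_imp_bounded[OF K] by (auto simp: bounded_pos)
    have KQ: "K \<subseteq> ccube 0 R"
    using R(2) by (auto intro: norm_le_mem_ccube)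
    have Q: "cube (ccube (0 :: real ^ 'n) R)" by (rule cube_ccube[OF R(1)])
    obtain b where b: "avg (ccube 0 R) (\<lambda>x. ennreal (?w x)) \<le> ennreal b"
      by (rule A1_product_avg[OF p0 C H1 H2 Q])
    have "(\<integral>\<^sup>+x. ennreal (norm (indicator K x *\<^sub>R ?w x)) \<partial>lebesgue)
        \<le> (\<integral>\<^sup>+x\<in>ccube 0 R. ennreal (?w x) \<partial>lebesgue)"
      using KQ pos by (intro nn_integral_mono) (auto simp: indicator_def abs_mult less_imp_le)
    also have "\<dots> \<le> ennreal b * emeasure lebesgue (ccube (0 :: real ^ 'n) R)"
      by (intro nn_integral_le_avg Q b) measurable
    also have "\<dots> < \<infinity>"
      using emeasure_cube(2)[OF Q] by (simp add: ennreal_mult_less_top del: emeasure_completion)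
    finally show ?thesis
      unfolding set_integrable_def using lmeasurable_compact[OF K]
      by (intro integrableI_bounded borel_measurable_scaleR borel_measurable_indicator) auto
  qed
  then show ?thesis unfolding weight_def using w by auto
qed

subsection \<open>Majorants from the two-weight hypotheses\<close>

lemma conj_exp_facts:
  assumes "1 < p"
  shows "1 < conj_exp p" "1 / p + 1 / conj_exp p = 1" "conj_exp p / p = conj_exp p - 1"
  using assms by (auto simp: conj_exp_def field_simps)

lemma weak_Lp_norm_le_iff:
  fixes w :: "real ^ 'n \<Rightarrow> real"
  assumes "0 < p" "0 \<le> D"
  shows "weak_Lp_norm p w h \<le> ennreal D \<longleftrightarrow>
    (\<forall>y>0. emeasure (weighted_measure w) {x. ennreal y < h x} \<le> ennreal ((D / y) powr p))"
proof -
  have "ennreal y * E \<le> ennreal D \<longleftrightarrow> E \<le> ennreal (D / y)" if "0 < y" for y E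
    using that assms(2)
    by (cases E) (auto simp: ennreal_mult[symmetric] pos_le_divide_eq mult.commute ennreal_mult_top top_unique)
  then show ?thesis
    unfolding weak_Lp_norm_def SUP_le_iff using assms by (auto simp: ennpowr_le_iff)
qed

lemma Lp_norm_le_iff:
  assumes "0 < p" "0 \<le> D"
  shows "Lp_norm p w h \<le> ennreal D \<longleftrightarrow>
    (\<integral>\<^sup>+x. ennpowr (h x) p \<partial>weighted_measure w) \<le> ennreal (D powr p)"
  unfolding Lp_norm_def by (rule ennpowr_le_iff[OF assms])

lemma weight_measurable [measurable_dest]: "weight w \<Longrightarrow> w \<in> borel_measurable lebesgue"
  by (simp add: weight_def)

lemma weight_pos: "weight w \<Longrightarrow> 0 < w x"
  by (simp add: weight_def)

lemma Lp_integral_real: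
  fixes w f :: "real ^ 'n \<Rightarrow> real"
  assumes [measurable]: "w \<in> borel_measurable lebesgue" "f \<in> borel_measurable lebesgue"
    and "\<And>x. 0 \<le> f x"
  shows "(\<integral>\<^sup>+x. ennpowr (ennreal (f x)) p \<partial>weighted_measure w)
    = (\<integral>\<^sup>+x. ennreal (f x powr p * w x) \<partial>lebesgue)"
proof -
  have "(\<integral>\<^sup>+x. ennpowr (ennreal (f x)) p \<partial>weighted_measure w)
      = (\<integral>\<^sup>+x. ennreal (w x) * ennpowr (ennreal (f x)) p \<partial>lebesgue)"
    by (intro nn_integral_density) measurable
  also have "\<dots> = (\<integral>\<^sup>+x. ennreal (f x powr p * w x) \<partial>lebesgue)"
    using assms(3) by (intro nn_integral_cong) (simp add: ennpowr_ennreal ennreal_mult'' mult.commute)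
  finally show ?thesis .
qed

lemma AE_weighted_measure:
  assumes w: "w \<in> borel_measurable lebesgue" "\<And>x. 0 < w x"
  shows "(AE x in weighted_measure w. P x) \<longleftrightarrow> (AE x in lebesgue. P x)"
  using w by (subst AE_density) auto

lemma weight_finite_on_compact:
  assumes w: "weight w" and K: "compact K"
  shows "emeasure (weighted_measure w) K < \<infinity>"
proof -
  have [measurable]: "w \<in> borel_measurable lebesgue" using w by (rule weight_measurable)
  have "integrable lebesgue (\<lambda>x. indicator K x *\<^sub>R w x)"
    using w K by (simp add: weight_def set_integrable_def)
  then have "(\<integral>\<^sup>+x. ennreal (norm (indicator K x *\<^sub>R w x)) \<partial>lebesgue) < \<infinity>"
    unfolding integrable_iff_bounded by blast
  also have "(\<integral>\<^sup>+x. ennreal (norm (indicator K x *\<^sub>R w x)) \<partial>lebesgue)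
      = (\<integral>\<^sup>+x\<in>K. ennreal (w x) \<partial>lebesgue)"
    using weight_pos[OF w] by (intro nn_integral_cong) (auto simp: indicator_def less_imp_le)
  also have "\<dots> = emeasure (weighted_measure w) K"
    using lmeasurable_compact[OF K] by (intro emeasure_density[symmetric]) auto
  finally show ?thesis .
qed

text \<open>\<open>H\<close> is the \<delta>-power of the maximal function of k = f^(1/\<delta>),
  whose norm in L^(\<delta>p)(u) is at most s^(1/\<delta>). Letting the level tend to infinity in
  the weak bound shows that the maximal function is finite v-almost everywhere, hence Lebesgue
  almost everywhere because v > 0.\<close>

lemma A_pair_majorant:
  fixes u v f :: "real ^ 'n \<Rightarrow> real"
  assumes u: "weight u" and v: "weight v" and pq: "0 < p" "0 < q" and \<delta>: "0 < \<delta>" "\<delta> < 1"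
    and Ca: "0 \<le> Ca" "\<And>k. k \<in> Lp_space (\<delta> * p) u \<Longrightarrow>
      weak_Lp_norm (\<delta> * q) v (HL_maximal k) \<le> ennreal Ca * Lp_norm (\<delta> * p) u (\<lambda>x. ennreal \<bar>k x\<bar>)"
    and f[measurable]: "f \<in> borel_measurable lebesgue" and fpos: "\<And>x. 0 < f x"
    and s: "0 < s" "(\<integral>\<^sup>+x. ennreal (f x powr p * u x) \<partial>lebesgue) \<le> ennreal (s powr p)"
  obtains H where "A1_bound (CR_const CARD('n) \<delta>) H" "AE x in lebesgue. f x \<le> H x"
    "\<forall>y>0. emeasure (weighted_measure v) {x. y < H x} \<le> ennreal ((Ca powr \<delta> * s / y) powr q)"
proof -
  have [measurable]: "u \<in> borel_measurable lebesgue" "v \<in> borel_measurable lebesgue"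
    using u v by (auto intro: weight_measurable)
  define k where "k = (\<lambda>x. f x powr (1 / \<delta>))"
  have k[measurable]: "k \<in> borel_measurable lebesgue" unfolding k_def by measurable
  have kpos: "0 < k x" for x using fpos[of x] by (simp add: k_def)
  let ?h = "\<lambda>x. ennreal (k x)" and ?D = "Ca * s powr (1 / \<delta>)"
  have HL: "HL_maximal k = MM ?h"
    using kpos by (simp add: HL_maximal_eq less_imp_le)
  have "(\<integral>\<^sup>+x. ennpowr (ennreal \<bar>k x\<bar>) (\<delta> * p) \<partial>weighted_measure u)
      = (\<integral>\<^sup>+x. ennreal (f x powr p * u x) \<partial>lebesgue)"
    using kpos \<delta> by (subst Lp_integral_real) (auto simp: k_def powr_powr)
  then have norm: "Lp_norm (\<delta> * p) u (\<lambda>x. ennreal \<bar>k x\<bar>) \<le> ennreal (s powr (1 / \<delta>))"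
    using s \<delta> pq by (subst Lp_norm_le_iff) (auto simp: powr_powr)
  then have "k \<in> Lp_space (\<delta> * p) u"
    unfolding Lp_space_def by (auto intro: le_less_trans)
  then have "weak_Lp_norm (\<delta> * q) v (MM ?h) \<le> ennreal Ca * Lp_norm (\<delta> * p) u (\<lambda>x. ennreal \<bar>k x\<bar>)"
    using Ca(2) unfolding HL[symmetric] by blast
  also have "\<dots> \<le> ennreal Ca * ennreal (s powr (1 / \<delta>))"
    by (intro mult_left_mono norm) simp
  also have "\<dots> = ennreal ?D" using Ca(1) by (simp add: ennreal_mult)
  finally have weak: "emeasure (weighted_measure v) {x. ennreal y < MM ?h x} \<le> ennreal ((?D / y) powr (\<delta> * q))"
    if "0 < y" for y
    using that Ca(1) \<delta> pq by (subst (asm) weak_Lp_norm_le_iff) auto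
  have M[measurable]: "MM ?h \<in> borel_measurable lebesgue" by measurable
  have "{x \<in> space lebesgue. ennreal y < MM ?h x} \<in> sets lebesgue" for y by measurable
  then have level: "{x. ennreal y < MM ?h x} \<in> sets (weighted_measure v)" for y by simp
  have "{x \<in> space lebesgue. MM ?h x = \<infinity>} \<in> sets lebesgue" by measurable
  then have top: "{x. MM ?h x = \<infinity>} \<in> sets (weighted_measure v)" by simp
  have "emeasure (weighted_measure v) {x. MM ?h x = \<infinity>} \<le> 0 + ennreal e" if e: "0 < e" for e
  proof -
    \<comment> \<open>Chosen to make (D/y)^(\<delta>q) at most e; the added 1 keeps y positive when
      the constant is 0.\<close>
    define y where "y = (?D + 1) / e powr (1 / (\<delta> * q))"
    have y: "0 < y" using e Ca(1) by (simp add: y_def add_nonneg_pos)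
    have "emeasure (weighted_measure v) {x. MM ?h x = \<infinity>} \<le> emeasure (weighted_measure v) {x. ennreal y < MM ?h x}"
      using level by (intro emeasure_mono) auto
    also have "\<dots> \<le> ennreal ((?D / y) powr (\<delta> * q))" by (rule weak[OF y])
    also have "?D / y \<le> e powr (1 / (\<delta> * q))"
    proof -
      have "?D * e powr (1 / (\<delta> * q)) \<le> (?D + 1) * e powr (1 / (\<delta> * q))"
        by (intro mult_right_mono) auto
      then show ?thesis
        using e Ca(1) by (simp add: y_def divide_le_eq add_nonneg_pos mult.commute)
    qed
    then have "ennreal ((?D / y) powr (\<delta> * q)) \<le> ennreal ((e powr (1 / (\<delta> * q))) powr (\<delta> * q))"
      using y Ca(1) \<delta> pq by (intro ennreal_leI powr_mono2) auto
    also have "(e powr (1 / (\<delta> * q))) powr (\<delta> * q) = e"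
      using e \<delta> pq by (simp add: powr_powr)
    finally show ?thesis by simp
  qed
  then have "emeasure (weighted_measure v) {x. MM ?h x = \<infinity>} \<le> 0"
    by (rule ennreal_le_epsilon)
  then have "{x. MM ?h x = \<infinity>} \<in> null_sets (weighted_measure v)"
    using top by (simp add: null_sets_def)
  then have "AE x in weighted_measure v. MM ?h x < \<infinity>"
    by (rule AE_I') (auto simp: less_top[symmetric])
  then have fin: "AE x in lebesgue. MM ?h x < \<infinity>"
    using weight_pos[OF v] by (subst (asm) AE_weighted_measure) auto
  have pos: "0 < (\<integral>\<^sup>+x. ?h x \<partial>lebesgue)"
    using kpos by (intro nn_integral_pos[where E = "ccube 0 1"] not_AE_notin_cube cube_ccube) auto
  let ?H = "maximal_power ?h \<delta>"
  have A1: "A1_bound (CR_const CARD('n) \<delta>) ?H"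
    by (intro A1_bound_maximal_power \<delta> fin pos) measurable
  have Hpos: "0 < ?H x" for x using A1 by (auto simp: A1_bound_def)
  have maj: "AE x in lebesgue. f x \<le> ?H x"
    using fin AE_le_MM[of ?h, simplified]
  proof eventually_elim
    case (elim x)
    have "f x = k x powr \<delta>" using fpos[of x] \<delta>(1) by (simp add: k_def powr_powr)
    then have "ennreal (f x) = ennpowr (?h x) \<delta>" using kpos[of x] by (simp add: ennpowr_ennreal)
    also have "\<dots> \<le> ennpowr (MM ?h x) \<delta>" using elim \<delta> by (intro ennpowr_mono) auto
    also have "\<dots> = ennreal (?H x)" using elim by (simp add: ennreal_maximal_power)
    finally show ?case using Hpos[of x] by (simp add: ennreal_le_iff)
  qed
  have wk: "emeasure (weighted_measure v) {x. y < ?H x} \<le> ennreal ((Ca powr \<delta> * s / y) powr q)"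
    if y: "0 < y" for y
  proof -
    \<comment> \<open>The inclusion holds only almost everywhere: where the maximal function is
      infinite, \<open>?H\<close> has the default value 1.\<close>
    have "AE x in lebesgue. x \<in> {x. y < ?H x} \<longrightarrow> x \<in> {x. ennreal (y powr (1 / \<delta>)) < MM ?h x}"
      using fin
    proof (eventually_elim, clarsimp)
      fix x assume x: "MM ?h x < top" "y < ?H x"
      show "ennreal (y powr (1 / \<delta>)) < MM ?h x"
      proof (rule ccontr)
        assume "\<not> ?thesis"
        then have "ennpowr (MM ?h x) \<delta> \<le> ennpowr (ennreal (y powr (1 / \<delta>))) \<delta>"
          using \<delta> by (intro ennpowr_mono) auto
        also have "\<dots> = ennreal y" using y \<delta> by (simp add: ennpowr_ennreal powr_powr)
        finally have "?H x \<le> y" using x y by (simp add: ennreal_maximal_power[symmetric] ennreal_le_iff)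
        then show False using x by simp
      qed
    qed
    then have "emeasure (weighted_measure v) {x. y < ?H x}
        \<le> emeasure (weighted_measure v) {x. ennreal (y powr (1 / \<delta>)) < MM ?h x}"
      using weight_pos[OF v] level by (intro emeasure_mono_AE) (simp_all add: AE_weighted_measure)
    also have "\<dots> \<le> ennreal ((?D / y powr (1 / \<delta>)) powr (\<delta> * q))"
      using y by (intro weak) simp
    also have "(?D / y powr (1 / \<delta>)) powr (\<delta> * q) = (Ca powr \<delta> * s / y) powr q"
      using y Ca(1) s(1) \<delta> by (simp add: powr_divide powr_mult powr_powr)
    finally show ?thesis .
  qed
  show ?thesis using wk by (intro that[OF A1 maj]) blast
qed

text \<open>\<open>H\<close> comes from k = (v * indicator E)^(1/\<mu>). Since v^q' * v^(1-q') = v,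
  the relevant integral of k is exactly v(E) = e, which produces the factor e^(1/q') absorbed at the
  end. The strong-type bound makes the maximal function finite almost everywhere, and e > 0 makes k
  nontrivial, so that \<open>H\<close> is a positive A_1 weight.\<close>

lemma S_pair_majorant:
  fixes u v :: "real ^ 'n \<Rightarrow> real"
  assumes u: "weight u" and v: "weight v" and pq: "1 < p" "1 < q" and \<mu>: "0 < \<mu>" "\<mu> < 1"
    and Cb: "0 \<le> Cb" "\<And>k. k \<in> Lp_space (\<mu> * conj_exp q) (\<lambda>x. v x powr (1 - conj_exp q)) \<Longrightarrow>
      Lp_norm (\<mu> * conj_exp p) (\<lambda>x. u x powr (1 - conj_exp p)) (HL_maximal k)
        \<le> ennreal Cb * Lp_norm (\<mu> * conj_exp q) (\<lambda>x. v x powr (1 - conj_exp q)) (\<lambda>x. ennreal \<bar>k x\<bar>)"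
    and E[measurable]: "E \<in> sets lebesgue" and e: "0 < e" "emeasure (weighted_measure v) E = ennreal e"
  obtains H where "A1_bound (CR_const CARD('n) \<mu>) H" "AE x in lebesgue. x \<in> E \<longrightarrow> v x \<le> H x"
    "(\<integral>\<^sup>+x. ennreal (H x powr conj_exp p * u x powr (1 - conj_exp p)) \<partial>lebesgue)
      \<le> ennreal ((Cb powr \<mu> * e powr (1 / conj_exp q)) powr conj_exp p)"
proof -
  define p' q' where "p' = conj_exp p" and "q' = conj_exp q"
  have pq': "1 < p'" "1 < q'" using conj_exp_facts pq by (auto simp: p'_def q'_def)
  have [measurable]: "u \<in> borel_measurable lebesgue" "v \<in> borel_measurable lebesgue"
    using u v by (auto intro: weight_measurable)
  have vpos: "0 < v x" and upos: "0 < u x" for x using weight_pos u v by auto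
  let ?u = "\<lambda>x. u x powr (1 - p')" and ?v = "\<lambda>x. v x powr (1 - q')"
  have u'pos: "0 < ?u x" for x using upos[of x] by simp
  define k where "k = (\<lambda>x. (v x * indicator E x) powr (1 / \<mu>))"
  have k[measurable]: "k \<in> borel_measurable lebesgue" unfolding k_def by measurable
  have knn: "0 \<le> k x" for x by (simp add: k_def)
  let ?h = "\<lambda>x. ennreal (k x)" and ?D = "Cb * e powr (1 / (\<mu> * q'))"
  have HL: "HL_maximal k = MM ?h"
    using knn by (simp add: HL_maximal_eq)
  have "(\<integral>\<^sup>+x. ennpowr (ennreal \<bar>k x\<bar>) (\<mu> * q') \<partial>weighted_measure ?v)
      = (\<integral>\<^sup>+x. ennreal (k x powr (\<mu> * q') * ?v x) \<partial>lebesgue)"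
    using knn by (subst Lp_integral_real) auto
  also have "\<dots> = (\<integral>\<^sup>+x\<in>E. ennreal (v x) \<partial>lebesgue)"
  proof (intro nn_integral_cong)
    fix x
    have "v x powr q' * v x powr (1 - q') = v x" using vpos[of x] by (simp add: powr_add[symmetric])
    then show "ennreal (k x powr (\<mu> * q') * ?v x) = ennreal (v x) * indicator E x"
      using \<mu> by (auto simp: k_def indicator_def powr_powr)
  qed
  also have "\<dots> = ennreal e" unfolding e(2)[symmetric] by (intro emeasure_density[symmetric]) auto
  finally have norm: "Lp_norm (\<mu> * q') ?v (\<lambda>x. ennreal \<bar>k x\<bar>) \<le> ennreal (e powr (1 / (\<mu> * q')))"
    using \<mu> pq' e(1) by (subst Lp_norm_le_iff) (auto simp: powr_powr)
  then have "k \<in> Lp_space (\<mu> * q') ?v"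
    unfolding Lp_space_def by (auto intro: le_less_trans)
  then have "Lp_norm (\<mu> * p') ?u (MM ?h) \<le> ennreal Cb * Lp_norm (\<mu> * q') ?v (\<lambda>x. ennreal \<bar>k x\<bar>)"
    using Cb(2) unfolding HL[symmetric] p'_def q'_def by blast
  also have "\<dots> \<le> ennreal Cb * ennreal (e powr (1 / (\<mu> * q')))"
    by (intro mult_left_mono norm) simp
  also have "\<dots> = ennreal ?D" using Cb(1) by (simp add: ennreal_mult)
  finally have "(\<integral>\<^sup>+x. ennpowr (MM ?h x) (\<mu> * p') \<partial>weighted_measure ?u) \<le> ennreal (?D powr (\<mu> * p'))"
    using Cb(1) \<mu> pq' by (subst (asm) Lp_norm_le_iff) auto
  also have "?D powr (\<mu> * p') = (Cb powr \<mu> * e powr (1 / q')) powr p'"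
    using Cb(1) \<mu> pq' by (simp add: powr_mult powr_powr)
  finally have bound: "(\<integral>\<^sup>+x. ennpowr (MM ?h x) (\<mu> * p') \<partial>weighted_measure ?u)
      \<le> ennreal ((Cb powr \<mu> * e powr (1 / q')) powr p')" .
  have M[measurable]: "MM ?h \<in> borel_measurable lebesgue" by measurable
  have "(\<integral>\<^sup>+x. ennpowr (MM ?h x) (\<mu> * p') \<partial>weighted_measure ?u) \<noteq> \<infinity>"
    using bound by (auto simp: top_unique)
  then have "AE x in weighted_measure ?u. ennpowr (MM ?h x) (\<mu> * p') \<noteq> \<infinity>"
    by (intro nn_integral_PInf_AE) auto
  then have "AE x in lebesgue. ennpowr (MM ?h x) (\<mu> * p') \<noteq> \<infinity>"
    using u'pos by (subst (asm) AE_weighted_measure) auto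
  then have fin: "AE x in lebesgue. MM ?h x < \<infinity>"
    by eventually_elim (auto simp: less_top[symmetric])
  have notE: "\<not> (AE x in lebesgue. x \<notin> E)"
  proof
    assume "AE x in lebesgue. x \<notin> E"
    then have "AE x in weighted_measure v. x \<notin> E" using vpos by (subst AE_weighted_measure) auto
    then have "emeasure (weighted_measure v) E = 0"
      using AE_iff_null_sets[of E "weighted_measure v"] by auto
    then show False using e by simp
  qed
  have pos: "0 < (\<integral>\<^sup>+x. ?h x \<partial>lebesgue)"
    using vpos notE by (intro nn_integral_pos[where E = E]) (auto simp: k_def vpos[THEN less_imp_neq, THEN not_sym])
  let ?H = "maximal_power ?h \<mu>"
  have A1: "A1_bound (CR_const CARD('n) \<mu>) ?H"
    by (intro A1_bound_maximal_power \<mu> fin pos) measurable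
  have [measurable]: "?H \<in> borel_measurable lebesgue" and Hpos: "0 < ?H x" for x
    using A1 by (auto simp: A1_bound_def)
  have maj: "AE x in lebesgue. x \<in> E \<longrightarrow> v x \<le> ?H x"
    using fin AE_le_MM[of ?h, simplified]
  proof (eventually_elim, intro impI)
    fix x assume x: "MM ?h x < \<infinity>" "?h x \<le> MM ?h x" "x \<in> E"
    have "v x = k x powr \<mu>" using vpos[of x] \<mu> x by (simp add: k_def powr_powr)
    then have "ennreal (v x) = ennpowr (?h x) \<mu>" using knn[of x] by (simp add: ennpowr_ennreal)
    also have "\<dots> \<le> ennpowr (MM ?h x) \<mu>" using x \<mu> by (intro ennpowr_mono) auto
    also have "\<dots> = ennreal (?H x)" using x by (simp add: ennreal_maximal_power)
    finally show "v x \<le> ?H x" using Hpos[of x] by (simp add: ennreal_le_iff)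
  qed
  have "(\<integral>\<^sup>+x. ennreal (?H x powr p' * ?u x) \<partial>lebesgue)
      = (\<integral>\<^sup>+x. ennpowr (ennreal (?H x)) p' \<partial>weighted_measure ?u)"
    using Hpos by (intro Lp_integral_real[symmetric]) (auto intro: less_imp_le)
  also have "\<dots> = (\<integral>\<^sup>+x. ennpowr (MM ?h x) (\<mu> * p') \<partial>weighted_measure ?u)"
  proof (rule nn_integral_cong_AE, subst AE_weighted_measure)
    show "AE x in lebesgue. ennpowr (ennreal (?H x)) p' = ennpowr (MM ?h x) (\<mu> * p')"
      using fin by eventually_elim (simp add: ennreal_maximal_power ennpowr_ennpowr \<mu>)
  qed (use u'pos in auto)
  finally have int: "(\<integral>\<^sup>+x. ennreal (?H x powr p' * ?u x) \<partial>lebesgue)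
      \<le> ennreal ((Cb powr \<mu> * e powr (1 / q')) powr p')" using bound by simp
  show ?thesis by (rule that[OF A1 maj int[unfolded p'_def q'_def]])
qed

subsection \<open>Extrapolation\<close>

text \<open>From f \<le> H2 and 1 - p0 \<le> 0 follows H2^(1-p0) \<le> f^(1-p0), hence f^p0 * w
  \<le> f * H1.\<close>

lemma Lp_norm_le_of_AE_le:
  fixes H1 H2 f :: "real ^ 'n \<Rightarrow> real"
  assumes p0: "1 \<le> p0" and [measurable]: "H1 \<in> borel_measurable lebesgue" "H2 \<in> borel_measurable lebesgue"
      "f \<in> borel_measurable lebesgue"
    and pos: "\<And>x. 0 < H1 x" "\<And>x. 0 < H2 x" "\<And>x. 0 < f x"
    and maj: "AE x in lebesgue. f x \<le> H2 x"
    and a: "0 \<le> a" "(\<integral>\<^sup>+x. ennreal (f x * H1 x) \<partial>lebesgue) \<le> ennreal a"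
  shows "Lp_norm p0 (\<lambda>x. H1 x * H2 x powr (1 - p0)) (\<lambda>x. ennreal (f x)) \<le> ennreal (a powr (1 / p0))"
proof -
  have "(\<integral>\<^sup>+x. ennpowr (ennreal (f x)) p0 \<partial>weighted_measure (\<lambda>x. H1 x * H2 x powr (1 - p0)))
      = (\<integral>\<^sup>+x. ennreal (f x powr p0 * (H1 x * H2 x powr (1 - p0))) \<partial>lebesgue)"
    using pos by (intro Lp_integral_real) (auto intro: less_imp_le)
  also have "\<dots> \<le> (\<integral>\<^sup>+x. ennreal (f x * H1 x) \<partial>lebesgue)"
  proof (rule nn_integral_mono_AE)
    show "AE x in lebesgue. ennreal (f x powr p0 * (H1 x * H2 x powr (1 - p0))) \<le> ennreal (f x * H1 x)"
      using maj
    proof eventually_elim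
      case (elim x)
      have "f x powr p0 * H2 x powr (1 - p0) \<le> f x powr p0 * f x powr (1 - p0)"
        using elim pos(3)[of x] p0 by (intro mult_left_mono powr_mono2') auto
      also have "\<dots> = f x" using pos(3)[of x] by (simp add: powr_add[symmetric])
      finally have "f x powr p0 * H2 x powr (1 - p0) * H1 x \<le> f x * H1 x"
        using pos(1)[of x] by (intro mult_right_mono) auto
      then show ?case by (intro ennreal_leI) (simp add: mult_ac)
    qed
  qed
  also note a(2)
  finally show ?thesis
    using p0 a(1) by (subst Lp_norm_le_iff) (auto simp: powr_powr)
qed

text \<open>The two-sided use of \<open>H2\<close>: as an upper bound for f it controls the
  right-hand norm, and as a function at most y on E it lets w dominate v there up to
  y^(p0-1).\<close>

lemma restricted_estimate:
  fixes u v f g H1 H2 :: "real ^ 'n \<Rightarrow> real"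
  assumes p0: "1 \<le> p0" and p: "1 < p" and u: "weight u" and v: "weight v"
    and f[measurable]: "f \<in> borel_measurable lebesgue" and fpos: "\<And>x. 0 < f x"
    and g[measurable]: "g \<in> borel_measurable lebesgue" and y: "0 < y" and B: "0 \<le> B"
    and hyp: "weak_Lp_norm p0 (\<lambda>x. H1 x * H2 x powr (1 - p0)) (\<lambda>x. ennreal (g x))
      \<le> ennreal B * Lp_norm p0 (\<lambda>x. H1 x * H2 x powr (1 - p0)) (\<lambda>x. ennreal (f x))"
    and H1: "H1 \<in> borel_measurable lebesgue" "\<And>x. 0 < H1 x"
    and H2: "H2 \<in> borel_measurable lebesgue" "\<And>x. 0 < H2 x"
    and maj: "AE x in lebesgue. f x \<le> H2 x" "AE x in lebesgue. x \<in> E \<longrightarrow> v x \<le> H1 x"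
    and E: "E \<in> sets lebesgue" "\<And>x. x \<in> E \<Longrightarrow> y < g x \<and> H2 x \<le> y"
    and s: "0 < s" "(\<integral>\<^sup>+x. ennreal (f x powr p * u x) \<partial>lebesgue) \<le> ennreal (s powr p)"
    and t: "0 < t" "(\<integral>\<^sup>+x. ennreal (H1 x powr conj_exp p * u x powr (1 - conj_exp p)) \<partial>lebesgue)
      \<le> ennreal (t powr conj_exp p)"
  shows "emeasure (weighted_measure v) E \<le> ennreal (B powr p0 * (s * t) / y)"
proof -
  let ?w = "\<lambda>x. H1 x * H2 x powr (1 - p0)"
  note H1(1)[measurable] H2(1)[measurable] E(1)[measurable]
  have [measurable]: "u \<in> borel_measurable lebesgue" "v \<in> borel_measurable lebesgue"
    using u v by (auto intro: weight_measurable)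
  have upos: "0 < u x" for x using weight_pos u by auto
  \<comment> \<open>Splitting off u^(1/p) gives the second factor the weight u^(-p'/p) = u^(1-p'),
    the one in the dual hypothesis.\<close>
  let ?F = "\<lambda>x. f x * u x powr (1 / p)" and ?G = "\<lambda>x. H1 x * u x powr (- 1 / p)"
  have "(\<integral>\<^sup>+x. ennreal (?F x * ?G x) \<partial>lebesgue) \<le> ennreal (s * t)"
  proof (rule Holder_nn_integral[OF _ _ _ _ p conj_exp_facts(1,2)[OF p] s(1) t(1)])
    have "?F x powr p = f x powr p * u x" for x
      using fpos[of x] upos[of x] p by (simp add: powr_mult powr_powr)
    then show "(\<integral>\<^sup>+x. ennreal (?F x powr p) \<partial>lebesgue) \<le> ennreal (s powr p)"
      using s(2) by simp
    have e: "- 1 / p * conj_exp p = 1 - conj_exp p" using conj_exp_facts(3)[OF p] by simp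
    have "?G x powr conj_exp p = H1 x powr conj_exp p * u x powr (1 - conj_exp p)" for x
      unfolding e[symmetric] using H1(2)[of x] by (simp only: powr_mult powr_powr powr_ge_zero less_imp_le)
    then show "(\<integral>\<^sup>+x. ennreal (?G x powr conj_exp p) \<partial>lebesgue) \<le> ennreal (t powr conj_exp p)"
      using t(2) by simp
  qed (use fpos H1(2) in \<open>auto simp: less_imp_le\<close>)
  moreover have "?F x * ?G x = f x * H1 x" for x
  proof -
    have "u x powr (1 / p) * u x powr (- 1 / p) = 1" using upos[of x] by (simp add: powr_add[symmetric])
    then show ?thesis by (metis mult.assoc mult.left_commute mult.right_neutral)
  qed
  ultimately have "(\<integral>\<^sup>+x. ennreal (f x * H1 x) \<partial>lebesgue) \<le> ennreal (s * t)"
    by (simp only:)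
  then have "Lp_norm p0 ?w (\<lambda>x. ennreal (f x)) \<le> ennreal ((s * t) powr (1 / p0))"
    using s t by (intro Lp_norm_le_of_AE_le p0 f H1 H2 fpos maj) auto
  then have "ennreal B * Lp_norm p0 ?w (\<lambda>x. ennreal (f x)) \<le> ennreal B * ennreal ((s * t) powr (1 / p0))"
    by (intro mult_left_mono) auto
  with hyp have "weak_Lp_norm p0 ?w (\<lambda>x. ennreal (g x)) \<le> ennreal B * ennreal ((s * t) powr (1 / p0))"
    by (rule order_trans)
  also have "\<dots> = ennreal (B * (s * t) powr (1 / p0))" using B by (simp add: ennreal_mult)
  finally have "emeasure (weighted_measure ?w) {x. ennreal y < ennreal (g x)}
      \<le> ennreal ((B * (s * t) powr (1 / p0) / y) powr p0)"
    using p0 B y by (subst (asm) weak_Lp_norm_le_iff) auto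
  also have "(B * (s * t) powr (1 / p0) / y) powr p0 = B powr p0 * (s * t) / y powr p0"
    using p0 B y s(1) t(1) by (simp add: powr_divide powr_mult powr_powr)
  finally have level: "emeasure (weighted_measure ?w) {x. ennreal y < ennreal (g x)}
      \<le> ennreal (B powr p0 * (s * t) / y powr p0)" .
  have "{x \<in> space lebesgue. ennreal y < ennreal (g x)} \<in> sets lebesgue" by measurable
  then have sets: "{x. ennreal y < ennreal (g x)} \<in> sets lebesgue" by simp
  have "emeasure (weighted_measure v) E = (\<integral>\<^sup>+x\<in>E. ennreal (v x) \<partial>lebesgue)"
    by (intro emeasure_density) auto
  also have "\<dots> \<le> (\<integral>\<^sup>+x. ennreal (y powr (p0 - 1)) * (ennreal (?w x) * indicator E x) \<partial>lebesgue)"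
  proof (rule nn_integral_mono_AE)
    show "AE x in lebesgue. ennreal (v x) * indicator E x
        \<le> ennreal (y powr (p0 - 1)) * (ennreal (?w x) * indicator E x)"
      using maj(2)
    proof eventually_elim
      case (elim x)
      show ?case
      proof (cases "x \<in> E")
        case True
        have "H1 x = H2 x powr (p0 - 1) * ?w x"
          using H2(2)[of x] by (simp add: mult.left_commute[of "H2 x powr (p0 - 1)"] powr_add[symmetric])
        also have "\<dots> \<le> y powr (p0 - 1) * ?w x"
          using True E(2)[of x] H1(2)[of x] H2(2)[of x] p0
          by (intro mult_right_mono powr_mono2) auto
        finally have "v x \<le> y powr (p0 - 1) * ?w x" using elim True by simp
        then show ?thesis
          using True H1(2)[of x] by (simp add: ennreal_mult[symmetric] less_imp_le ennreal_leI)
      qed simp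
    qed
  qed
  also have "\<dots> = ennreal (y powr (p0 - 1)) * (\<integral>\<^sup>+x\<in>E. ennreal (?w x) \<partial>lebesgue)"
    by (intro nn_integral_cmult) measurable
  also have "(\<integral>\<^sup>+x\<in>E. ennreal (?w x) \<partial>lebesgue) = emeasure (weighted_measure ?w) E"
    by (intro emeasure_density[symmetric]) auto
  also have "ennreal (y powr (p0 - 1)) * emeasure (weighted_measure ?w) E
      \<le> ennreal (y powr (p0 - 1)) * ennreal (B powr p0 * (s * t) / y powr p0)"
  proof (rule mult_left_mono)
    have "emeasure (weighted_measure ?w) E \<le> emeasure (weighted_measure ?w) {x. ennreal y < ennreal (g x)}"
      using E(2) sets y by (intro emeasure_mono) (auto simp: ennreal_less_iff)
    then show "emeasure (weighted_measure ?w) E \<le> ennreal (B powr p0 * (s * t) / y powr p0)"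
      using level by (rule order_trans)
  qed simp
  also have "\<dots> = ennreal (y powr (p0 - 1) * (B powr p0 * (s * t) / y powr p0))"
    using s t y by (intro ennreal_mult[symmetric]) auto
  \<comment> \<open>Because g and \<open>H2\<close> are cut at the same y, the powers combine to 1/y
    for every p0.\<close>
  also have "y powr (p0 - 1) * (B powr p0 * (s * t) / y powr p0) = B powr p0 * (s * t) / y"
    using y by (simp add: powr_diff)
  finally show ?thesis .
qed

text \<open>As 1 - 1/q' = 1/q, cancelling e^(1/q') leaves e^(1/q) \<le> c. The cancellation is
  legitimate because e is a positive real.\<close>

lemma absorb_dual_power:
  assumes q: "1 < q" and e: "0 < e" and le: "e \<le> c * e powr (1 / conj_exp q)"
  shows "e \<le> c powr q"
proof -
  have "e = e powr (1 / q) * e powr (1 / conj_exp q)"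
    using e conj_exp_facts(2)[OF q] by (simp add: powr_add[symmetric])
  then have "e powr (1 / q) * e powr (1 / conj_exp q) \<le> c * e powr (1 / conj_exp q)"
    using le by simp
  then have c: "e powr (1 / q) \<le> c" using e by (simp add: mult_le_cancel_right)
  have "e = (e powr (1 / q)) powr q" using e q by (simp add: powr_powr)
  also have "\<dots> \<le> c powr q" using c q by (intro powr_mono2) auto
  finally show ?thesis .
qed

theorem theorem3p5:
  fixes p0 p q \<delta> \<mu> :: real
    and \<phi> :: "real \<Rightarrow> real"
    and u v :: "real ^ 'n \<Rightarrow> real"
  assumes "1 \<le> p0"
    and "locally_bounded \<phi>"
    and "1 < p" and "1 < q"
    and "weight u" and "weight v"
    and "0 < \<delta>" and "\<delta> < 1"
    and "(u, v) \<in> A_pair (\<delta> * p) (\<delta> * q)"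
    and "0 < \<mu>" and "\<mu> < 1"
    and "((\<lambda>x. v x powr (1 - conj_exp q)), (\<lambda>x. u x powr (1 - conj_exp p)))
           \<in> S_pair (\<mu> * conj_exp q) (\<mu> * conj_exp p)"
  shows "\<exists>C::real. \<forall>f g :: real ^ 'n \<Rightarrow> real.
    f \<in> borel_measurable lebesgue \<longrightarrow> (\<forall>x. 0 < f x) \<longrightarrow>
    g \<in> borel_measurable lebesgue \<longrightarrow> (\<forall>x. 0 < g x) \<longrightarrow>
    (\<forall>w\<in>Ap_class p0. weak_Lp_norm p0 w (\<lambda>x. ennreal (g x))
        \<le> ennreal (\<phi> (enn2real (Ap_const p0 w))) * Lp_norm p0 w (\<lambda>x. ennreal (f x))) \<longrightarrow>
    weak_Lp_norm q v (\<lambda>x. ennreal (g x)) \<le> ennreal C * Lp_norm p u (\<lambda>x. ennreal (f x))"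
proof -
  note p0 = assms(1) and pq = assms(3,4) and u = assms(5) and v = assms(6)
    and \<delta> = assms(7,8) and \<mu> = assms(10,11)
  have [measurable]: "u \<in> borel_measurable lebesgue" "v \<in> borel_measurable lebesgue"
    using u v by (auto intro: weight_measurable)
  have upos: "0 < u x" for x using weight_pos u by auto
  have pq0: "0 < p" "0 < q" using pq by auto
  obtain Ca' where Ca': "\<And>k. k \<in> Lp_space (\<delta> * p) u \<Longrightarrow>
      weak_Lp_norm (\<delta> * q) v (HL_maximal k) \<le> ennreal Ca' * Lp_norm (\<delta> * p) u (\<lambda>x. ennreal \<bar>k x\<bar>)"
    using assms(9) by (auto simp: A_pair_def)
  \<comment> \<open>The given constant may be negative; \<open>ennreal\<close> reads it as 0, so the
    truncation keeps the estimate.\<close>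
  define Ca where "Ca = max Ca' 0"
  have "ennreal Ca = ennreal Ca'" by (simp add: Ca_def max_def ennreal_neg)
  then have Ca: "0 \<le> Ca" "\<And>k. k \<in> Lp_space (\<delta> * p) u \<Longrightarrow>
      weak_Lp_norm (\<delta> * q) v (HL_maximal k) \<le> ennreal Ca * Lp_norm (\<delta> * p) u (\<lambda>x. ennreal \<bar>k x\<bar>)"
    using Ca' by (simp_all add: Ca_def del: ennreal_max_0)
  obtain Cb' where Cb': "\<And>k. k \<in> Lp_space (\<mu> * conj_exp q) (\<lambda>x. v x powr (1 - conj_exp q)) \<Longrightarrow>
      Lp_norm (\<mu> * conj_exp p) (\<lambda>x. u x powr (1 - conj_exp p)) (HL_maximal k)
        \<le> ennreal Cb' * Lp_norm (\<mu> * conj_exp q) (\<lambda>x. v x powr (1 - conj_exp q)) (\<lambda>x. ennreal \<bar>k x\<bar>)"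
    using assms(12) by (auto simp: S_pair_def)
  \<comment> \<open>Strictly positive, because the Hoelder bound t = Cb^\<mu> * e^(1/q') has to
    be.\<close>
  define Cb where "Cb = max Cb' 1"
  have Cb: "0 < Cb" "\<And>k. k \<in> Lp_space (\<mu> * conj_exp q) (\<lambda>x. v x powr (1 - conj_exp q)) \<Longrightarrow>
      Lp_norm (\<mu> * conj_exp p) (\<lambda>x. u x powr (1 - conj_exp p)) (HL_maximal k)
        \<le> ennreal Cb * Lp_norm (\<mu> * conj_exp q) (\<lambda>x. v x powr (1 - conj_exp q)) (\<lambda>x. ennreal \<bar>k x\<bar>)"
  proof -
    show "0 < Cb" by (simp add: Cb_def)
    fix k assume "k \<in> Lp_space (\<mu> * conj_exp q) (\<lambda>x. v x powr (1 - conj_exp q))"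
    from Cb'[OF this] show "Lp_norm (\<mu> * conj_exp p) (\<lambda>x. u x powr (1 - conj_exp p)) (HL_maximal k)
        \<le> ennreal Cb * Lp_norm (\<mu> * conj_exp q) (\<lambda>x. v x powr (1 - conj_exp q)) (\<lambda>x. ennreal \<bar>k x\<bar>)"
      by (rule order_trans) (intro mult_right_mono ennreal_leI, auto simp: Cb_def)
  qed
  let ?N = "CARD('n)"
  \<comment> \<open>A common bound for the A_p0 constants of all weights w below, independent of f,
    g, y and E.\<close>
  define K where "K = CR_const ?N \<mu> * CR_const ?N \<delta> powr (p0 - 1)"
  obtain B' where B': "\<And>t. 0 < t \<Longrightarrow> t < K + 1 \<Longrightarrow> \<phi> t \<le> B'"
  proof -
    have K: "0 < K + 1"
      using CR_const_pos[OF \<mu>(2), of ?N] by (simp add: K_def add_nonneg_pos)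
    then have "bdd_above (\<phi> ` {0<..<K + 1})" using assms(2) by (auto simp: locally_bounded_def)
    then obtain M where "\<forall>t\<in>{0<..<K + 1}. \<phi> t \<le> M" by (auto simp: bdd_above_def)
    then show thesis by (intro that[of M]) auto
  qed
  \<comment> \<open>Local boundedness speaks of positive arguments below an open endpoint: hence K +
    1 above, to include K, and the separate value \<phi> 0, since the real A_p0 constant is only
    known to be nonnegative here.\<close>
  define B where "B = max 1 (max B' (\<phi> 0))"
  have B: "1 \<le> B" "\<And>t. 0 \<le> t \<Longrightarrow> t \<le> K \<Longrightarrow> \<phi> t \<le> B"
  proof -
    fix t assume "0 \<le> t" "t \<le> K"
    then show "\<phi> t \<le> B" using B'[of t] by (cases "t = 0") (auto simp: B_def le_max_iff_disj)
  qed (simp add: B_def)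
  define D where "D = B powr p0 * Cb powr \<mu>"
  define X where "X = Ca powr \<delta> + D"
  have D: "0 < D" "D \<le> X" "Ca powr \<delta> \<le> X" "0 < X"
    using B(1) Cb(1) by (auto simp: D_def X_def add_nonneg_pos)
  show ?thesis
  \<comment> \<open>The level set of g splits into two parts, each of measure at most (X * s / y)^q,
    and 2 \<le> 2^q moves the factor 2 inside the power.\<close>
  proof (intro exI[of _ "2 * X"] allI impI)
    fix f g :: "real ^ 'n \<Rightarrow> real"
    assume f[measurable]: "f \<in> borel_measurable lebesgue" and fpos: "\<forall>x. 0 < f x"
      and g[measurable]: "g \<in> borel_measurable lebesgue" and gpos: "\<forall>x. 0 < g x"
      and hyp: "\<forall>w\<in>Ap_class p0. weak_Lp_norm p0 w (\<lambda>x. ennreal (g x))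
        \<le> ennreal (\<phi> (enn2real (Ap_const p0 w))) * Lp_norm p0 w (\<lambda>x. ennreal (f x))"
    let ?L = "Lp_norm p u (\<lambda>x. ennreal (f x))"
    show "weak_Lp_norm q v (\<lambda>x. ennreal (g x)) \<le> ennreal (2 * X) * ?L"
    proof (cases "?L = \<infinity>")
      case True
      then show ?thesis using D(4) by (simp add: ennreal_mult_top ennreal_eq_0_iff)
    next
      case False
      then obtain s where s0: "0 \<le> s" "?L = ennreal s" by (cases ?L) auto
      have int: "(\<integral>\<^sup>+x. ennpowr (ennreal (f x)) p \<partial>weighted_measure u)
          = (\<integral>\<^sup>+x. ennreal (f x powr p * u x) \<partial>lebesgue)"
        using fpos by (intro Lp_integral_real) (auto intro: less_imp_le)
      have s2: "(\<integral>\<^sup>+x. ennreal (f x powr p * u x) \<partial>lebesgue) \<le> ennreal (s powr p)"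
        using Lp_norm_le_iff[of p s u "\<lambda>x. ennreal (f x)"] pq s0 int by simp
      have "0 < f x powr p * u x" for x using fpos upos[of x] by (simp add: less_imp_neq[THEN not_sym])
      then have "0 < (\<integral>\<^sup>+x. ennreal (f x powr p * u x) \<partial>lebesgue)"
        by (intro nn_integral_pos[where E = "ccube 0 1"] not_AE_notin_cube cube_ccube) auto
      \<comment> \<open>Positivity of f excludes norm 0, as the Hoelder step requires s > 0.\<close>
      then have "s \<noteq> 0" using s2 by auto
      then have s: "0 < s" using s0 by simp
      obtain H2 where H2: "A1_bound (CR_const ?N \<delta>) H2" "AE x in lebesgue. f x \<le> H2 x"
        "\<forall>y>0. emeasure (weighted_measure v) {x. y < H2 x} \<le> ennreal ((Ca powr \<delta> * s / y) powr q)"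
        by (rule A_pair_majorant[OF u v pq0 \<delta> Ca f fpos[rule_format] s s2])
      have H2m[measurable]: "H2 \<in> borel_measurable lebesgue" and H2pos: "\<And>x. 0 < H2 x"
        using H2(1) by (auto simp: A1_bound_def)
      have restr: "emeasure (weighted_measure v) E \<le> ennreal ((D * s / y) powr q)"
        if y: "0 < y" and E: "E \<in> sets lebesgue" "\<And>x. x \<in> E \<Longrightarrow> y < g x \<and> H2 x \<le> y"
          and fin: "emeasure (weighted_measure v) E < \<infinity>" for y E
      proof -
        obtain e where e: "0 \<le> e" "emeasure (weighted_measure v) E = ennreal e"
          using fin by (cases "emeasure (weighted_measure v) E") auto
        show ?thesis
        proof (cases "e = 0")
          case False
          then have e0: "0 < e" using e by simp
          let ?t = "Cb powr \<mu> * e powr (1 / conj_exp q)"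
          obtain H1 where H1: "A1_bound (CR_const ?N \<mu>) H1" "AE x in lebesgue. x \<in> E \<longrightarrow> v x \<le> H1 x"
            "(\<integral>\<^sup>+x. ennreal (H1 x powr conj_exp p * u x powr (1 - conj_exp p)) \<partial>lebesgue)
              \<le> ennreal (?t powr conj_exp p)"
            by (rule S_pair_majorant[OF u v pq \<mu> less_imp_le[OF Cb(1)] Cb(2) E(1) e0 e(2)])
          have H1m[measurable]: "H1 \<in> borel_measurable lebesgue" and H1pos: "\<And>x. 0 < H1 x"
            using H1(1) by (auto simp: A1_bound_def)
          let ?w = "\<lambda>x. H1 x * H2 x powr (1 - p0)"
          have Ap: "Ap_const p0 ?w \<le> ennreal K"
            unfolding K_def by (intro A1_product_Ap_const p0 CR_const_pos \<mu> \<delta> H1 H2)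
          have "weight ?w"
            by (rule A1_product_weight[OF p0 CR_const_pos[OF \<mu>(2)] CR_const_pos[OF \<delta>(2)] H1(1) H2(1)])
          then have "?w \<in> Ap_class p0"
            using Ap by (auto simp: Ap_class_def intro: le_less_trans)
          then have "weak_Lp_norm p0 ?w (\<lambda>x. ennreal (g x))
              \<le> ennreal (\<phi> (enn2real (Ap_const p0 ?w))) * Lp_norm p0 ?w (\<lambda>x. ennreal (f x))"
            using hyp by blast
          also have "\<dots> \<le> ennreal B * Lp_norm p0 ?w (\<lambda>x. ennreal (f x))"
          proof (intro mult_right_mono ennreal_leI B)
            have "0 \<le> K" using CR_const_pos[OF \<mu>(2), of ?N] by (simp add: K_def)
            then show "enn2real (Ap_const p0 ?w) \<le> K"
              using Ap by (simp add: enn2real_leI)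
          qed auto
          finally have "emeasure (weighted_measure v) E \<le> ennreal (B powr p0 * (s * ?t) / y)"
            using B(1) fpos Cb(1) e0
            by (intro restricted_estimate[OF p0 pq(1) u v f _ g y _ _ H1m H1pos H2m H2pos H2(2) H1(2) E s s2 _ H1(3)]) auto
          also have "B powr p0 * (s * ?t) / y = D * s / y * e powr (1 / conj_exp q)"
            by (simp add: D_def)
          finally have "e \<le> D * s / y * e powr (1 / conj_exp q)"
            using e D(1) s y by (simp add: ennreal_le_iff)
          then have "e \<le> (D * s / y) powr q" by (rule absorb_dual_power[OF pq(2) e0])
          then show ?thesis using e by (simp add: ennreal_leI)
        qed (use e in simp)
      qed
      have "weak_Lp_norm q v (\<lambda>x. ennreal (g x)) \<le> ennreal (2 * X * s)"
      proof (subst weak_Lp_norm_le_iff, goal_cases)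
        case 3
        show ?case
        proof (intro allI impI)
          fix y :: real assume y: "0 < y"
          \<comment> \<open>Local integrability of v makes each bounded piece of finite v-measure,
            so absorption applies to it; the resulting bound does not involve k and survives the
            passage to the union.\<close>
          define E where "E = (\<lambda>k. {x \<in> space lebesgue. y < g x \<and> H2 x \<le> y} \<inter> ccube 0 (real k))"
          have "{x \<in> space lebesgue. y < g x \<and> H2 x \<le> y} \<in> sets lebesgue" by measurable
          then have E: "E k \<in> sets lebesgue" for k
            unfolding E_def by (intro sets.Int sets_ccube)
          have "incseq E"
            unfolding E_def incseq_def by (intro allI impI Int_mono ccube_mono) auto
          then have "emeasure (weighted_measure v) (\<Union>k. E k) = (SUP k. emeasure (weighted_measure v) (E k))"
            using E by (intro SUP_emeasure_incseq[symmetric]) auto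
          also have "\<dots> \<le> ennreal ((D * s / y) powr q)"
          proof (intro SUP_least restr[OF y E])
            fix k
            have "emeasure (weighted_measure v) (E k) \<le> emeasure (weighted_measure v) (ccube 0 (real k))"
              by (intro emeasure_mono) (auto simp: E_def)
            also have "\<dots> < \<infinity>"
              by (rule weight_finite_on_compact[OF v]) (simp add: ccube_def compact_cbox)
            finally show "emeasure (weighted_measure v) (E k) < \<infinity>" .
          qed (auto simp: E_def)
          finally have UE: "emeasure (weighted_measure v) (\<Union>k. E k) \<le> ennreal ((D * s / y) powr q)" .
          have "{x \<in> space lebesgue. y < H2 x} \<in> sets lebesgue" by measurable
          then have H2s: "{x. y < H2 x} \<in> sets lebesgue" by simp
          have "{x. ennreal y < ennreal (g x)} \<subseteq> {x. y < H2 x} \<union> (\<Union>k. E k)"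
          proof
            fix x assume "x \<in> {x. ennreal y < ennreal (g x)}"
            then have gx: "y < g x" using y by (simp add: ennreal_less_iff)
            obtain k where k: "norm x \<le> real k" using real_arch_simple by blast
            then have "x \<in> ccube 0 (real k)" by (intro norm_le_mem_ccube) simp
            then show "x \<in> {x. y < H2 x} \<union> (\<Union>k. E k)"
              using gx by (auto simp: E_def not_less)
          qed
          then have "emeasure (weighted_measure v) {x. ennreal y < ennreal (g x)}
              \<le> emeasure (weighted_measure v) ({x. y < H2 x} \<union> (\<Union>k. E k))"
            using E H2s by (intro emeasure_mono) auto
          also have "\<dots> \<le> emeasure (weighted_measure v) {x. y < H2 x} + emeasure (weighted_measure v) (\<Union>k. E k)"
            using E H2s by (intro emeasure_subadditive) auto
          also have "\<dots> \<le> ennreal ((Ca powr \<delta> * s / y) powr q) + ennreal ((D * s / y) powr q)"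
            by (intro add_mono H2(3)[rule_format, OF y] UE)
          also have "\<dots> \<le> ennreal ((X * s / y) powr q) + ennreal ((X * s / y) powr q)"
            using y s D pq by (intro add_mono ennreal_leI powr_mono2 divide_right_mono mult_right_mono) auto
          also have "\<dots> = ennreal (2 * (X * s / y) powr q)"
            by (simp add: ennreal_plus[symmetric] del: ennreal_plus)
          also have "\<dots> \<le> ennreal ((2 * X * s / y) powr q)"
          proof (rule ennreal_leI)
            have "2 * (X * s / y) powr q \<le> 2 powr q * (X * s / y) powr q"
              using pq powr_mono[of 1 q "2::real"] by (intro mult_right_mono) auto
            also have "\<dots> = (2 * X * s / y) powr q"
              using y s D by (simp add: powr_mult[symmetric] mult.assoc)
            finally show "2 * (X * s / y) powr q \<le> (2 * X * s / y) powr q" .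
          qed
          finally show "emeasure (weighted_measure v) {x. ennreal y < ennreal (g x)}
              \<le> ennreal ((2 * X * s / y) powr q)" .
        qed
      qed (use pq D s in auto)
      then show ?thesis using s0 D by (simp add: ennreal_mult)
    qed
  qed
qed

end
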